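(* Let $\mathcal{G}$ be a class of graphs and let $\mathcal{G}_B$ be the class of graphs that appear as blocks of graphs in $\mathcal{G}$. If List Colouring is polynomial-time solvable on $\mathcal{G}_B$, then List Colouring is polynomial-time solvable on $\mathcal{G}$.
   Context: A colouring of a graph $G=(V,E)$ is a map $c:V\to\{1,2,\dots\}$ with $c(u)\neq c(v)$ for every edge $uv$. A list assignment $L$ gives each vertex $u$ a finite set $L(u)\subseteq\{1,2,\dots\}$; a colouring respects $L$ if $c(u)\in L(u)$ for all $u$. List Colouring: given a graph $G$ and a list assignment $L$, decide whether $G$ has a colouring respecting $L$. A block of a graph is a maximal connected subgraph that cannot be disconnected by removing one vertex (so a block is a $2$-connected subgraph, a $K_2$, or an isolated vertex). *)

theory Defs
  imports "Graph_Theory.Graph_Theory" "HOL-Computational_Algebra.Polynomial"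
begin

section \<open>Polynomial time\<close>

text \<open>
  The machine model is the language WHILE of N. D. Jones (Computability and Complexity from a
  Programming Perspective, MIT Press, 1997): imperative programs over binary trees built from a
  single atom, where the test of a conditional or loop is "not equal to the atom". Every tree
  operation has unit cost. A value created in \<open>t\<close> steps has a representation as a
  directed acyclic graph with at most \<open>t\<close> nodes more than the input, so the unit cost measure is
  polynomially related to the running time of Turing machines and the decision problems solvable
  in polynomial time are the same (Jones, Part IV).
\<close>

datatype val = Leaf | Node val val

fun val_fst :: "val \<Rightarrow> val" where
  "val_fst Leaf = Leaf"
| "val_fst (Node a b) = a"

fun val_snd :: "val \<Rightarrow> val" where
  "val_snd Leaf = Leaf"
| "val_snd (Node a b) = b"

datatype expr = Var nat | Atom | Cons_expr expr expr | Hd expr | Tl expr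

type_synonym state = "nat \<Rightarrow> val"

primrec eval_expr :: "expr \<Rightarrow> state \<Rightarrow> val" where
  "eval_expr (Var x) s = s x"
| "eval_expr Atom s = Leaf"
| "eval_expr (Cons_expr e f) s = Node (eval_expr e s) (eval_expr f s)"
| "eval_expr (Hd e) s = val_fst (eval_expr e s)"
| "eval_expr (Tl e) s = val_snd (eval_expr e s)"

primrec expr_cost :: "expr \<Rightarrow> nat" where
  "expr_cost (Var x) = 1"
| "expr_cost Atom = 1"
| "expr_cost (Cons_expr e f) = expr_cost e + expr_cost f + 1"
| "expr_cost (Hd e) = expr_cost e + 1"
| "expr_cost (Tl e) = expr_cost e + 1"

datatype prog =
    Skip
  | Assign nat expr
  | Seq prog prog
  | Cond expr prog prog
  | Loop expr prog

text \<open>\<open>exec c s t s'\<close>: started in \<open>s\<close>, the program \<open>c\<close> halts in \<open>s'\<close> after exactly \<open>t\<close> steps.\<close>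

inductive exec :: "prog \<Rightarrow> state \<Rightarrow> nat \<Rightarrow> state \<Rightarrow> bool" where
  exec_Skip: "exec Skip s 1 s"
| exec_Assign: "exec (Assign x e) s (expr_cost e + 1) (s(x := eval_expr e s))"
| exec_Seq: "exec c s t s' \<Longrightarrow> exec d s' t' s'' \<Longrightarrow> exec (Seq c d) s (t + t') s''"
| exec_Cond_true:
    "eval_expr e s \<noteq> Leaf \<Longrightarrow> exec c s t s' \<Longrightarrow> exec (Cond e c d) s (expr_cost e + 1 + t) s'"
| exec_Cond_false:
    "eval_expr e s = Leaf \<Longrightarrow> exec d s t s' \<Longrightarrow> exec (Cond e c d) s (expr_cost e + 1 + t) s'"
| exec_Loop_true:
    "eval_expr e s \<noteq> Leaf \<Longrightarrow> exec c s t s' \<Longrightarrow> exec (Loop e c) s' t' s''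
      \<Longrightarrow> exec (Loop e c) s (expr_cost e + 1 + t + t') s''"
| exec_Loop_false: "eval_expr e s = Leaf \<Longrightarrow> exec (Loop e c) s (expr_cost e + 1) s"

inductive_cases exec_SkipE: "exec Skip s t s'"
inductive_cases exec_AssignE: "exec (Assign x e) s t s'"
inductive_cases exec_SeqE: "exec (Seq c d) s t s'"
inductive_cases exec_CondE: "exec (Cond e c d) s t s'"
inductive_cases exec_LoopE: "exec (Loop e c) s t s'"

lemma exec_deterministic:
  "exec c s t s' \<Longrightarrow> exec c s u s0 \<Longrightarrow> u = t \<and> s0 = s'"
proof (induction arbitrary: u s0 rule: exec.induct)
  case (exec_Skip s)
  then show ?case by (auto elim: exec_SkipE)
next
  case (exec_Assign x e s)
  then show ?case by (auto elim: exec_AssignE)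
next
  case (exec_Seq c s t s' d t' s'')
  from exec_Seq.prems show ?case
  proof (rule exec_SeqE)
    fix v r v' assume u: "u = v + v'" and 1: "exec c s v r" and 2: "exec d r v' s0"
    show ?thesis using exec_Seq.IH(1)[OF 1] exec_Seq.IH(2)[of v' s0] 2 u by simp
  qed
next
  case (exec_Cond_true e s c t s' d)
  from exec_Cond_true.prems show ?case
  proof (rule exec_CondE)
    fix v assume u: "u = Suc (expr_cost e + v)" and 1: "exec c s v s0"
    show ?thesis using exec_Cond_true.IH[OF 1] u by simp
  qed (use exec_Cond_true.hyps in simp_all)
next
  case (exec_Cond_false e s d t s' c)
  from exec_Cond_false.prems show ?case
  proof (rule exec_CondE)
    fix v assume u: "u = Suc (expr_cost e + v)" and 1: "exec d s v s0"
    show ?thesis using exec_Cond_false.IH[OF 1] u by simp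
  qed (use exec_Cond_false.hyps in simp_all)
next
  case (exec_Loop_true e s c t s' t' s'')
  from exec_Loop_true.prems show ?case
  proof (rule exec_LoopE)
    fix v r v' assume u: "u = Suc (expr_cost e + v + v')"
      and 1: "exec c s v r" and 2: "exec (Loop e c) r v' s0"
    show ?thesis using exec_Loop_true.IH(1)[OF 1] exec_Loop_true.IH(2)[of v' s0] 2 u by simp
  qed (use exec_Loop_true.hyps in simp)
next
  case (exec_Loop_false e s c)
  from exec_Loop_false.prems show ?case
    by (rule exec_LoopE) (use exec_Loop_false.hyps in simp_all)
qed

primrec enc_bool :: "bool \<Rightarrow> val" where
  "enc_bool False = Leaf"
| "enc_bool True = Node Leaf Leaf"

text \<open>Input and output are passed in variable 0; all other variables are initially \<open>Leaf\<close>.\<close>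

definition runs_within :: "prog \<Rightarrow> val \<Rightarrow> nat \<Rightarrow> val \<Rightarrow> bool" where
  "runs_within c d T r \<longleftrightarrow> (\<exists>t s. exec c ((\<lambda>_. Leaf)(0 := d)) t s \<and> t \<le> T \<and> s 0 = r)"

text \<open>
  A problem is given by its instances, the codes of an instance (an instance may have several,
  since a finite set can be listed in any order) and the set of yes-instances. Nothing is required
  of the program on inputs that do not encode an instance. The size of a code is its number of
  inner nodes.
\<close>

definition poly_time_solvable :: "'i set \<Rightarrow> ('i \<Rightarrow> val \<Rightarrow> bool) \<Rightarrow> ('i \<Rightarrow> bool) \<Rightarrow> bool" where
  "poly_time_solvable I codes yes \<longleftrightarrow>
    (\<exists>c (p :: nat poly). \<forall>i\<in>I. \<forall>d. codes i d \<longrightarrow>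
       runs_within c d (poly p (size d)) (enc_bool (yes i)))"

section \<open>Encodings\<close>

text \<open>Binary notation, least significant bit first, without leading zeros.\<close>

fun enc_nat :: "nat \<Rightarrow> val" where
  "enc_nat n = (if n = 0 then Leaf else Node (enc_bool (odd n)) (enc_nat (n div 2)))"

declare enc_nat.simps [simp del]

primrec enc_list :: "('a \<Rightarrow> val) \<Rightarrow> 'a list \<Rightarrow> val" where
  "enc_list f [] = Leaf"
| "enc_list f (x # xs) = Node (f x) (enc_list f xs)"

section \<open>List Colouring\<close>

text \<open>
  A finite simple graph is a \<open>pair_graph\<close>, i.e. a finite loop-free symmetric set of arcs: the edge
  \<open>uv\<close> is the two arcs \<open>(u, v)\<close> and \<open>(v, u)\<close>.
\<close>

definition colouring :: "'a pair_pre_digraph \<Rightarrow> ('a \<Rightarrow> nat) \<Rightarrow> bool" where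
  "colouring G c \<longleftrightarrow> (\<forall>u\<in>pverts G. 1 \<le> c u) \<and> (\<forall>(u, v)\<in>parcs G. c u \<noteq> c v)"

definition list_assignment :: "'a pair_pre_digraph \<Rightarrow> ('a \<Rightarrow> nat set) \<Rightarrow> bool" where
  "list_assignment G L \<longleftrightarrow> (\<forall>u\<in>pverts G. finite (L u) \<and> L u \<subseteq> {1..})"

definition respects_lists :: "'a pair_pre_digraph \<Rightarrow> ('a \<Rightarrow> nat set) \<Rightarrow> ('a \<Rightarrow> nat) \<Rightarrow> bool" where
  "respects_lists G L c \<longleftrightarrow> (\<forall>u\<in>pverts G. c u \<in> L u)"

text \<open>
  A code of \<open>(G, L)\<close> consists of a list of the vertices, each paired with a list of the
  colours in its set, and of a list of the arcs, all without repetitions and in any order.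
\<close>

definition encodes_instance ::
    "nat pair_pre_digraph \<times> (nat \<Rightarrow> nat set) \<Rightarrow> val \<Rightarrow> bool" where
  "encodes_instance = (\<lambda>(G, L) d. \<exists>vs es cols.
     distinct vs \<and> set vs = pverts G \<and>
     distinct es \<and> set es = parcs G \<and>
     (\<forall>v\<in>set vs. distinct (cols v) \<and> set (cols v) = L v) \<and>
     d = Node (enc_list (\<lambda>v. Node (enc_nat v) (enc_list enc_nat (cols v))) vs)
              (enc_list (\<lambda>(u, v). Node (enc_nat u) (enc_nat v)) es))"

definition list_colouring_poly_time_on :: "nat pair_pre_digraph set \<Rightarrow> bool" where
  "list_colouring_poly_time_on \<G> \<longleftrightarrow>
     poly_time_solvable {(G, L). G \<in> \<G> \<and> list_assignment G L} encodes_instance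
       (\<lambda>(G, L). \<exists>c. colouring G c \<and> respects_lists G L c)"

section \<open>Blocks\<close>

text \<open>
  The library's \<^const>\<open>connected\<close> fails for the graph without vertices, so a single vertex, which
  is not disconnected by its removal, is treated separately.
\<close>

definition nonseparable :: "('a, 'b) pre_digraph \<Rightarrow> bool" where
  "nonseparable H \<longleftrightarrow> graph H \<and> connected H \<and>
     (\<forall>v\<in>verts H. verts H \<noteq> {v} \<longrightarrow> connected (pre_digraph.del_vert H v))"

definition is_block :: "'a pair_pre_digraph \<Rightarrow> 'a pair_pre_digraph \<Rightarrow> bool" where
  "is_block H G \<longleftrightarrow> pre_digraph.max_subgraph (with_proj G) nonseparable (with_proj H)"

definition block_class :: "'a pair_pre_digraph set \<Rightarrow> 'a pair_pre_digraph set" where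
  "block_class \<G> = {H. \<exists>G\<in>\<G>. is_block H G}"

end

theory Submission
  imports Defs
begin

text \<open>
  Repeat the following for every arc \<open>(u, v)\<close>: delete from the list of \<open>u\<close> each colour \<open>k\<close> for which the
  block of the edge \<open>uv\<close> has no list colouring giving \<open>u\<close> the colour \<open>k\<close>; this is a question about the
  block, in which \<open>u\<close> has the list \<open>{k}\<close>. No colouring of the graph is lost. Once the lists are stable,
  the graph is colourable iff all lists are nonempty: split at a cut vertex, colour one part, and then
  the other part starting from the colour that the cut vertex has received.

  The block of \<open>uv\<close> consists of the vertices \<open>w\<close> such that no vertex \<open>x \<noteq> w\<close> separates \<open>w\<close> from both
  \<open>u\<close> and \<open>v\<close>, so it is found by reachability tests in the graphs \<open>G - x\<close>.
\<close>

section \<open>Programs as subroutines\<close>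

text \<open>Two restrictions shape the construction. The program assumed for blocks only decides,
  and it is reliable only on codes of instances whose graph lies in \<open>block_class \<G>\<close>.
  Hence a question may alter nothing but the lists, and fixing a colour has to be expressed by the
  list \<open>[k]\<close>. Moreover each query must be shown to concern a genuine block, so
  polynomial time is always stated relative to a domain, and loops carry invariants that keep the
  queries inside it. Iterating to a fixpoint avoids building a block tree and choosing an order on
  it: stability at every single arc is all that the gluing argument needs. The number of rounds can
  be fixed in advance because each unstable round deletes a colour. An isolated vertex has no arc
  and is never tested; there a nonempty list suffices. Apart from a few combinators no program is
  written out: since \<open>ptime\<close> is closed under composition, pairing, branching and
  folding over lists, the algorithm can be given by HOL functions.\<close>

abbreviation blank :: state where
  "blank \<equiv> \<lambda>_. Leaf"

definition runs :: "prog \<Rightarrow> state \<Rightarrow> nat \<Rightarrow> state \<Rightarrow> bool" where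
  "runs c s T s' \<longleftrightarrow> (\<exists>t\<le>T. exec c s t s')"

lemma runs_mono: "runs c s T s' \<Longrightarrow> T \<le> T' \<Longrightarrow> runs c s T' s'"
  unfolding runs_def by (meson order_trans)

lemma runs_Skip: "runs Skip s 1 s"
  unfolding runs_def using exec_Skip by blast

lemma runs_Assign: "runs (Assign x e) s (expr_cost e + 1) (s(x := eval_expr e s))"
  unfolding runs_def using exec_Assign by blast

lemma runs_Seq: "runs c s T s' \<Longrightarrow> runs d s' T' s'' \<Longrightarrow> runs (Seq c d) s (T + T') s''"
  unfolding runs_def by (meson add_mono exec_Seq)

lemma runs_Cond:
  assumes "eval_expr e s \<noteq> Leaf \<Longrightarrow> runs c s T s'" "eval_expr e s = Leaf \<Longrightarrow> runs d s T s'"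
  shows "runs (Cond e c d) s (expr_cost e + 1 + T) s'"
  using assms unfolding runs_def
  by (cases "eval_expr e s = Leaf") (meson add_left_mono exec_Cond_false exec_Cond_true)+

lemma runs_Loop_true:
  "eval_expr e s \<noteq> Leaf \<Longrightarrow> runs c s T s' \<Longrightarrow> runs (Loop e c) s' T' s''
    \<Longrightarrow> runs (Loop e c) s (expr_cost e + 1 + T + T') s''"
  unfolding runs_def by (meson add_left_mono add_mono exec_Loop_true)

lemma runs_Loop_false: "eval_expr e s = Leaf \<Longrightarrow> runs (Loop e c) s (expr_cost e + 1) s"
  unfolding runs_def using exec_Loop_false by blast

section \<open>Relocating the variables of a program\<close>

primrec shift_expr :: "nat \<Rightarrow> expr \<Rightarrow> expr" where
  "shift_expr k (Var x) = Var (x + k)"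
| "shift_expr k Atom = Atom"
| "shift_expr k (Cons_expr e f) = Cons_expr (shift_expr k e) (shift_expr k f)"
| "shift_expr k (Hd e) = Hd (shift_expr k e)"
| "shift_expr k (Tl e) = Tl (shift_expr k e)"

primrec shift :: "nat \<Rightarrow> prog \<Rightarrow> prog" where
  "shift k Skip = Skip"
| "shift k (Assign x e) = Assign (x + k) (shift_expr k e)"
| "shift k (Seq c d) = Seq (shift k c) (shift k d)"
| "shift k (Cond e c d) = Cond (shift_expr k e) (shift k c) (shift k d)"
| "shift k (Loop e c) = Loop (shift_expr k e) (shift k c)"

text \<open>A stack with one frame: the variables below \<open>k\<close> are the caller's, and the
  callee works on those from \<open>k\<close> on as if they began at 0.\<close>

definition stack_state :: "nat \<Rightarrow> state \<Rightarrow> state \<Rightarrow> state" where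
  "stack_state k r s = (\<lambda>x. if x < k then r x else s (x - k))"

lemma stack_state_update: "stack_state k r (s(x := v)) = (stack_state k r s)(x + k := v)"
  by (auto simp: stack_state_def fun_eq_iff)

lemma eval_shift_expr: "eval_expr (shift_expr k e) (stack_state k r s) = eval_expr e s"
  by (induction e) (auto simp: stack_state_def)

lemma expr_cost_shift_expr: "expr_cost (shift_expr k e) = expr_cost e"
  by (induction e) auto

text \<open>The shifted program neither reads nor writes below \<open>k\<close>, and shifting leaves
  the costs of expressions unchanged, so the run is the same step by step.\<close>

lemma exec_shift:
  "exec c s t s' \<Longrightarrow> exec (shift k c) (stack_state k r s) t (stack_state k r s')"
proof (induction rule: exec.induct)
  case (exec_Assign x e s)
  show ?case
    using exec.exec_Assign[of "x + k" "shift_expr k e" "stack_state k r s"]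
    by (simp add: stack_state_update eval_shift_expr expr_cost_shift_expr flip: fun_upd_def)
next
  case (exec_Cond_true e s c t s' d)
  then show ?case
    using exec.exec_Cond_true[of "shift_expr k e" "stack_state k r s" "shift k c"]
    by (simp add: eval_shift_expr expr_cost_shift_expr)
next
  case (exec_Cond_false e s d t s' c)
  then show ?case
    using exec.exec_Cond_false[of "shift_expr k e" "stack_state k r s" "shift k d"]
    by (simp add: eval_shift_expr expr_cost_shift_expr)
next
  case (exec_Loop_true e s c t s' t' s'')
  then show ?case
    using exec.exec_Loop_true[of "shift_expr k e" "stack_state k r s" "shift k c"]
    by (simp add: eval_shift_expr expr_cost_shift_expr)
next
  case (exec_Loop_false e s c)
  then show ?case
    using exec.exec_Loop_false[of "shift_expr k e" "stack_state k r s" "shift k c"]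
    by (simp add: eval_shift_expr expr_cost_shift_expr)
qed (use exec_Skip exec_Seq in auto)

primrec assigned_bound :: "prog \<Rightarrow> nat" where
  "assigned_bound Skip = 0"
| "assigned_bound (Assign x e) = Suc x"
| "assigned_bound (Seq c d) = max (assigned_bound c) (assigned_bound d)"
| "assigned_bound (Cond e c d) = max (assigned_bound c) (assigned_bound d)"
| "assigned_bound (Loop e c) = assigned_bound c"

lemma exec_frame: "exec c s t s' \<Longrightarrow> assigned_bound c \<le> x \<Longrightarrow> s' x = s x"
  by (induction rule: exec.induct) auto

text \<open>Variable 0 is spared because it holds the result.\<close>

primrec clear_below :: "nat \<Rightarrow> prog" where
  "clear_below 0 = Skip"
| "clear_below (Suc n) = Seq (clear_below n) (Assign (Suc n) Atom)"

lemma runs_clear_below: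
  "runs (clear_below n) s (2 * n + 1) (\<lambda>x. if 1 \<le> x \<and> x \<le> n then Leaf else s x)"
proof (induction n)
  case 0
  have "(\<lambda>x. if 1 \<le> x \<and> x \<le> 0 then Leaf else s x) = s" by auto
  then show ?case using runs_Skip by simp
next
  case (Suc n)
  have "(\<lambda>x. if 1 \<le> x \<and> x \<le> Suc n then Leaf else s x)
      = (\<lambda>x. if 1 \<le> x \<and> x \<le> n then Leaf else s x)(Suc n := Leaf)"
    by (auto simp: fun_eq_iff)
  then show ?case
    using runs_Seq[OF Suc runs_Assign[of "Suc n" Atom]] by (simp add: algebra_simps)
qed

text \<open>The condition on the final state makes such programs composable by \<^const>\<open>Seq\<close>.\<close>

definition computes :: "prog \<Rightarrow> val \<Rightarrow> nat \<Rightarrow> val \<Rightarrow> bool" where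
  "computes c d T r \<longleftrightarrow> runs c (blank(0 := d)) T (blank(0 := r))"

text \<open>Only variables below \<open>assigned_bound c\<close> can have been written, so all
  litter left by \<open>c\<close> can be removed at a cost that depends on the program alone:
  \<open>n\<close> assignments of cost 2 and one \<open>Skip\<close>.\<close>

lemma runs_within_imp_computes:
  assumes "runs_within c d T r"
  shows "computes (Seq c (clear_below (assigned_bound c))) d
           (T + (2 * assigned_bound c + 1)) r"
proof -
  let ?n = "assigned_bound c"
  obtain t s where e: "exec c (blank(0 := d)) t s" "t \<le> T" "s 0 = r"
    using assms unfolding runs_within_def by auto
  have "s x = Leaf" if "?n \<le> x" "x \<noteq> 0" for x
    using exec_frame[OF e(1) that(1)] that(2) by simp
  then have "(\<lambda>x. if 1 \<le> x \<and> x \<le> ?n then Leaf else s x) = blank(0 := r)"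
    using e(3) by (auto simp: fun_eq_iff)
  moreover have "runs c (blank(0 := d)) T s"
    using e unfolding runs_def by auto
  ultimately show ?thesis
    unfolding computes_def using runs_Seq[OF _ runs_clear_below[of ?n s]] by metis
qed

lemma computes_imp_runs_within: "computes c d T r \<Longrightarrow> runs_within c d T r"
  unfolding computes_def runs_def runs_within_def by (metis fun_upd_same)

text \<open>The final assignment empties the only variable of the callee's frame that is not
  \<open>Leaf\<close> after a clean run. Thus the frame is blank again, and a later call may use the
  same \<open>k\<close>.\<close>

definition call :: "nat \<Rightarrow> nat \<Rightarrow> expr \<Rightarrow> prog \<Rightarrow> prog" where
  "call k y e c =
     Seq (Assign k e) (Seq (shift k c) (Seq (Assign y (Var k)) (Assign k Atom)))"

lemma runs_call:
  assumes c: "computes c d T r" and s: "\<And>x. k \<le> x \<Longrightarrow> s x = Leaf"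
    and d: "eval_expr e s = d" and y: "y < k"
  shows "runs (call k y e c) s (T + (expr_cost e + 5)) (s(y := r))"
proof -
  have st: "s(k := v) = stack_state k s (blank(0 := v))" for v
    using s by (auto simp: stack_state_def fun_eq_iff)
  have 1: "runs (Assign k e) s (expr_cost e + 1) (s(k := d))"
    using runs_Assign[of k e s] d by simp
  have 2: "runs (shift k c) (s(k := d)) T (s(k := r))"
    using c exec_shift unfolding st computes_def runs_def by blast
  have 3: "runs (Assign y (Var k)) (s(k := r)) 2 (s(k := r, y := r))"
    using runs_Assign[of y "Var k" "s(k := r)"] by (simp add: numeral_2_eq_2)
  have "s(k := r, y := r, k := Leaf) = s(y := r)"
    using y s[of k] by (auto simp: fun_eq_iff)
  then have 4: "runs (Assign k Atom) (s(k := r, y := r)) 2 (s(y := r))"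
    using runs_Assign[of k Atom "s(k := r, y := r)"] by (simp add: numeral_2_eq_2)
  show ?thesis
    unfolding call_def
    by (rule runs_mono[OF runs_Seq[OF 1 runs_Seq[OF 2 runs_Seq[OF 3 4]]]]) simp
qed

section \<open>Polynomial-time functions on encoded data\<close>

lemma poly_nat_mono: "m \<le> n \<Longrightarrow> poly p m \<le> poly p n" for p :: "nat poly"
  by (induction p) (auto intro!: mult_mono add_mono)

text \<open>
  The unit cost measure allows a program to build trees of exponential size, hence the separate
  bound on the size of the result, without which composition would fail.
\<close>

definition ptime :: "('i \<Rightarrow> val) \<Rightarrow> 'i set \<Rightarrow> ('i \<Rightarrow> val) \<Rightarrow> bool" where
  "ptime e D f \<longleftrightarrow> (\<exists>c (p :: nat poly). \<forall>i\<in>D.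
     computes c (e i) (poly p (size (e i))) (f i) \<and> size (f i) \<le> poly p (size (e i)))"

lemma ptimeI:
  fixes p q :: "nat poly"
  assumes "\<And>i. i \<in> D \<Longrightarrow> computes c (e i) (poly p (size (e i))) (f i)"
    and "\<And>i. i \<in> D \<Longrightarrow> size (f i) \<le> poly q (size (e i))"
  shows "ptime e D f"
  unfolding ptime_def
proof (intro exI ballI conjI)
  fix i assume i: "i \<in> D"
  show "computes c (e i) (poly (p + q) (size (e i))) (f i)"
    using assms(1)[OF i] unfolding computes_def by (rule runs_mono) simp
  show "size (f i) \<le> poly (p + q) (size (e i))"
    using assms(2)[OF i] by simp
qed

lemma ptimeE:
  assumes "ptime e D f"
  obtains c and p :: "nat poly" where
    "\<And>i. i \<in> D \<Longrightarrow> computes c (e i) (poly p (size (e i))) (f i)"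
    "\<And>i. i \<in> D \<Longrightarrow> size (f i) \<le> poly p (size (e i))"
  using assms unfolding ptime_def by blast

lemma ptime_cong:
  assumes "ptime e D f" "\<And>i. i \<in> D \<Longrightarrow> f i = g i"
  shows "ptime e D g"
  using assms unfolding ptime_def by metis

lemma ptime_subset: "ptime e D f \<Longrightarrow> D' \<subseteq> D \<Longrightarrow> ptime e D' f"
  unfolding ptime_def by blast

lemma ptime_id: "ptime e D (\<lambda>i. e i)"
proof (rule ptimeI)
  show "computes Skip (e i) (poly [:1:] (size (e i))) (e i)" for i
    using runs_Skip by (simp add: computes_def)
  show "size (e i) \<le> poly [:0, 1:] (size (e i))" for i by simp
qed

text \<open>A fixed tree is the value of a closed expression, whose cost does not depend on the
  input.\<close>

lemma ptime_const: "ptime e D (\<lambda>i. v)"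
proof -
  have "\<exists>x. \<forall>s. eval_expr x s = v"
  proof (induction v)
    case Leaf
    show ?case by (rule exI[of _ Atom]) simp
  next
    case (Node a b)
    then obtain x y where "\<forall>s. eval_expr x s = a" "\<forall>s. eval_expr y s = b" by blast
    then show ?case by (intro exI[of _ "Cons_expr x y"]) simp
  qed
  then obtain x where x: "\<And>s. eval_expr x s = v" by blast
  show ?thesis
  proof (rule ptimeI)
    show "computes (Assign 0 x) (e i) (poly [:expr_cost x + 1:] (size (e i))) v" for i
      using runs_Assign[of 0 x "blank(0 := e i)"] by (simp add: computes_def x)
    show "size v \<le> poly [:size v:] (size (e i))" for i by simp
  qed
qed

text \<open>Function application: \<open>\<phi>\<close> assembles the arguments that \<open>f\<close> expects.\<close>

lemma ptime_comp:
  assumes "ptime e' D' (\<lambda>j. e (\<phi> j))" "ptime e D f" "\<And>j. j \<in> D' \<Longrightarrow> \<phi> j \<in> D"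
  shows "ptime e' D' (\<lambda>j. f (\<phi> j))"
proof -
  obtain c p where c: "\<And>i. i \<in> D' \<Longrightarrow> computes c (e' i) (poly p (size (e' i))) (e (\<phi> i))"
    "\<And>i. i \<in> D' \<Longrightarrow> size (e (\<phi> i)) \<le> poly p (size (e' i))"
    using ptimeE[OF assms(1)] by blast
  obtain d q where d: "\<And>i. i \<in> D \<Longrightarrow> computes d (e i) (poly q (size (e i))) (f i)"
    "\<And>i. i \<in> D \<Longrightarrow> size (f i) \<le> poly q (size (e i))"
    using ptimeE[OF assms(2)] by blast
  have le: "poly q (size (e (\<phi> i))) \<le> poly (pcompose q p) (size (e' i))" if "i \<in> D'" for i
    unfolding poly_pcompose by (rule poly_nat_mono[OF c(2)[OF that]])
  show ?thesis
  proof (rule ptimeI)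
    fix i assume i: "i \<in> D'"
    show "computes (Seq c d) (e' i) (poly (p + pcompose q p) (size (e' i))) (f (\<phi> i))"
      using runs_mono[OF runs_Seq[OF c(1)[OF i, unfolded computes_def]
            d(1)[OF assms(3)[OF i], unfolded computes_def]]] le[OF i]
      by (simp add: computes_def)
    show "size (f (\<phi> i)) \<le> poly (pcompose q p) (size (e' i))"
      using d(2)[OF assms(3)[OF i]] le[OF i] by simp
  qed
qed

lemma ptime_val_fst: assumes "ptime e D f" shows "ptime e D (\<lambda>i. val_fst (f i))"
proof -
  have "ptime id UNIV val_fst"
  proof (rule ptimeI)
    show "computes (Assign 0 (Hd (Var 0))) (id d) (poly [:3:] (size (id d))) (val_fst d)" for d
      using runs_Assign[of 0 "Hd (Var 0)" "blank(0 := d)"]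
      by (simp add: computes_def numeral_3_eq_3)
    show "size (val_fst d) \<le> poly [:0, 1:] (size (id d))" for d by (cases d) auto
  qed
  from ptime_comp[OF _ this, of e D f] assms show ?thesis by simp
qed

lemma ptime_val_snd: assumes "ptime e D f" shows "ptime e D (\<lambda>i. val_snd (f i))"
proof -
  have "ptime id UNIV val_snd"
  proof (rule ptimeI)
    show "computes (Assign 0 (Tl (Var 0))) (id d) (poly [:3:] (size (id d))) (val_snd d)" for d
      using runs_Assign[of 0 "Tl (Var 0)" "blank(0 := d)"]
      by (simp add: computes_def numeral_3_eq_3)
    show "size (val_snd d) \<le> poly [:0, 1:] (size (id d))" for d by (cases d) auto
  qed
  from ptime_comp[OF _ this, of e D f] assms show ?thesis by simp
qed

text \<open>The first result is kept in variable 1 while the input is still in variable 0; only the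
  second call may overwrite the input.\<close>

lemma ptime_Node:
  assumes "ptime e D f" "ptime e D g"
  shows "ptime e D (\<lambda>i. Node (f i) (g i))"
proof -
  obtain c p where c: "\<And>i. i \<in> D \<Longrightarrow> computes c (e i) (poly p (size (e i))) (f i)"
    "\<And>i. i \<in> D \<Longrightarrow> size (f i) \<le> poly p (size (e i))"
    using ptimeE[OF assms(1)] by blast
  obtain d q where d: "\<And>i. i \<in> D \<Longrightarrow> computes d (e i) (poly q (size (e i))) (g i)"
    "\<And>i. i \<in> D \<Longrightarrow> size (g i) \<le> poly q (size (e i))"
    using ptimeE[OF assms(2)] by blast
  let ?C = "Seq (call 2 1 (Var 0) c) (Seq (call 2 0 (Var 0) d)
     (Seq (Assign 0 (Cons_expr (Var 1) (Var 0))) (Assign 1 Atom)))"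
  show ?thesis
  proof (rule ptimeI)
    fix i assume i: "i \<in> D"
    let ?s = "blank(0 := e i)"
    let ?r = "Node (f i) (g i)" and ?n = "size (e i)"
    have 1: "runs (call 2 1 (Var 0) c) ?s (poly p ?n + (expr_cost (Var 0) + 5)) (?s(1 := f i))"
      by (rule runs_call[OF c(1)[OF i]]) auto
    have 2: "runs (call 2 0 (Var 0) d) (?s(1 := f i)) (poly q ?n + (expr_cost (Var 0) + 5))
        (?s(1 := f i, 0 := g i))"
      by (rule runs_call[OF d(1)[OF i]]) auto
    have 3: "runs (Assign 0 (Cons_expr (Var 1) (Var 0))) (?s(1 := f i, 0 := g i)) 4
        (?s(1 := f i, 0 := ?r))"
      using runs_Assign[of 0 "Cons_expr (Var 1) (Var 0)" "?s(1 := f i, 0 := g i)"]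
      by (simp add: eval_nat_numeral)
    have "?s(1 := f i, 0 := ?r, 1 := Leaf) = blank(0 := ?r)" by (auto simp: fun_eq_iff)
    then have 4: "runs (Assign 1 Atom) (?s(1 := f i, 0 := ?r)) 2 (blank(0 := ?r))"
      using runs_Assign[of 1 Atom "?s(1 := f i, 0 := ?r)"] by (simp add: eval_nat_numeral)
    from runs_Seq[OF 1 runs_Seq[OF 2 runs_Seq[OF 3 4]]]
    show "computes ?C (e i) (poly (p + q + [:18:]) ?n) ?r"
      unfolding computes_def by (rule runs_mono) simp
    show "size (Node (f i) (g i)) \<le> poly (p + q + [:1:]) (size (e i))"
      using c(2)[OF i] d(2)[OF i] by simp
  qed
qed

text \<open>Each branch has to behave only on the inputs that reach it. This is what allows a
  subroutine with a restricted domain to be called behind a test. Variable 1 is emptied first, so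
  that both branches start from a clean state.\<close>

lemma ptime_if:
  assumes "ptime e D (\<lambda>i. enc_bool (P i))"
    and "ptime e {i \<in> D. P i} f" and "ptime e {i \<in> D. \<not> P i} g"
  shows "ptime e D (\<lambda>i. if P i then f i else g i)"
proof -
  obtain b r where b: "\<And>i. i \<in> D \<Longrightarrow> computes b (e i) (poly r (size (e i))) (enc_bool (P i))"
    "\<And>i. i \<in> D \<Longrightarrow> size (enc_bool (P i)) \<le> poly r (size (e i))"
    using ptimeE[OF assms(1)] by blast
  obtain c p where c: "\<And>i. i \<in> {i \<in> D. P i} \<Longrightarrow> computes c (e i) (poly p (size (e i))) (f i)"
    "\<And>i. i \<in> {i \<in> D. P i} \<Longrightarrow> size (f i) \<le> poly p (size (e i))"
    using ptimeE[OF assms(2)] by blast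
  obtain d q where d: "\<And>i. i \<in> {i \<in> D. \<not> P i} \<Longrightarrow> computes d (e i) (poly q (size (e i))) (g i)"
    "\<And>i. i \<in> {i \<in> D. \<not> P i} \<Longrightarrow> size (g i) \<le> poly q (size (e i))"
    using ptimeE[OF assms(3)] by blast
  let ?C = "Seq (call 2 1 (Var 0) b)
     (Cond (Var 1) (Seq (Assign 1 Atom) c) (Seq (Assign 1 Atom) d))"
  show ?thesis
  proof (rule ptimeI)
    fix i assume i: "i \<in> D"
    let ?s = "blank(0 := e i)" and ?r = "if P i then f i else g i"
    let ?s' = "?s(1 := enc_bool (P i))" and ?n = "size (e i)"
    have 1: "runs (call 2 1 (Var 0) b) ?s (poly r ?n + (expr_cost (Var 0) + 5)) ?s'"
      by (rule runs_call[OF b(1)[OF i]]) auto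
    have "?s'(1 := Leaf) = ?s" by (auto simp: fun_eq_iff)
    then have 2: "runs (Assign 1 Atom) ?s' (expr_cost Atom + 1) ?s"
      using runs_Assign[of 1 Atom ?s'] by simp
    have "runs (Cond (Var 1) (Seq (Assign 1 Atom) c) (Seq (Assign 1 Atom) d)) ?s'
       (expr_cost (Var 1) + 1 + (expr_cost Atom + 1 + (poly p ?n + poly q ?n))) (blank(0 := ?r))"
    proof (rule runs_Cond; rule runs_Seq[OF 2])
      assume "eval_expr (Var 1) ?s' \<noteq> Leaf"
      then have P: "P i" by (cases "P i") auto
      show "runs c ?s (poly p ?n + poly q ?n) (blank(0 := ?r))"
        using c(1)[of i, unfolded computes_def] i P by (auto intro: runs_mono)
    next
      assume "eval_expr (Var 1) ?s' = Leaf"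
      then have P: "\<not> P i" by (cases "P i") auto
      show "runs d ?s (poly p ?n + poly q ?n) (blank(0 := ?r))"
        using d(1)[of i, unfolded computes_def] i P by (auto intro: runs_mono)
    qed
    from runs_Seq[OF 1 this]
    show "computes ?C (e i) (poly (r + p + q + [:10:]) ?n) ?r"
      unfolding computes_def by (rule runs_mono) simp
    show "size ?r \<le> poly (p + q) ?n"
      using c(2)[of i] d(2)[of i] i by (auto simp: trans_le_add1 trans_le_add2)
  qed
qed

section \<open>Loops over encoded lists\<close>

definition enc_pair :: "('a \<Rightarrow> val) \<Rightarrow> ('b \<Rightarrow> val) \<Rightarrow> 'a \<times> 'b \<Rightarrow> val" where
  "enc_pair g h j = Node (g (fst j)) (h (snd j))"

lemma size_enc_list_member: "x \<in> set xs \<Longrightarrow> size (g x) < size (enc_list g xs)"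
  by (induction xs) auto

lemma length_le_size_enc_list: "length xs \<le> size (enc_list g xs)"
  by (induction xs) auto

text \<open>The second argument of the invariant is the part of the list still to be processed.\<close>

lemma ptime_fold:
  assumes list: "ptime e D (\<lambda>i. enc_list g (xs i))"
    and init: "ptime e D (\<lambda>i. h (init i))"
    and step: "ptime (enc_pair g (enc_pair h e))
       {j. snd (snd j) \<in> D \<and> (\<exists>ys. Inv (snd (snd j)) (fst j # ys) (fst (snd j)))}
       (\<lambda>j. h (step (snd (snd j)) (fst j) (fst (snd j))))"
    and Inv_init: "\<And>i. i \<in> D \<Longrightarrow> Inv i (xs i) (init i)"
    and Inv_step: "\<And>i x ys a. i \<in> D \<Longrightarrow> Inv i (x # ys) a \<Longrightarrow> Inv i ys (step i x a)"
    and Inv_size: "\<And>i ys a. i \<in> D \<Longrightarrow> Inv i ys a \<Longrightarrow> size (h a) \<le> poly q (size (e i))"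
  shows "ptime e D (\<lambda>i. h (fold (step i) (xs i) (init i)))"
proof -
  obtain cl pl where cl: "\<And>i. i \<in> D \<Longrightarrow> computes cl (e i) (poly pl (size (e i))) (enc_list g (xs i))"
    "\<And>i. i \<in> D \<Longrightarrow> size (enc_list g (xs i)) \<le> poly pl (size (e i))"
    using ptimeE[OF list] by blast
  obtain ci pi where ci: "\<And>i. i \<in> D \<Longrightarrow> computes ci (e i) (poly pi (size (e i))) (h (init i))"
    "\<And>i. i \<in> D \<Longrightarrow> size (h (init i)) \<le> poly pi (size (e i))"
    using ptimeE[OF init] by blast
  let ?e = "enc_pair g (enc_pair h e)"
  let ?D = "{j. snd (snd j) \<in> D \<and> (\<exists>ys. Inv (snd (snd j)) (fst j # ys) (fst (snd j)))}"
  obtain cs ps where cs': "\<And>j. j \<in> ?D \<Longrightarrow> computes cs (?e j) (poly ps (size (?e j)))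
      (h (step (snd (snd j)) (fst j) (fst (snd j))))"
    "\<And>j. j \<in> ?D \<Longrightarrow> size (h (step (snd (snd j)) (fst j) (fst (snd j)))) \<le> poly ps (size (?e j))"
    using ptimeE[OF assms(3)] by blast
  have cs: "computes cs (Node (g x) (Node (h a) (e i)))
      (poly ps (size (Node (g x) (Node (h a) (e i))))) (h (step i x a))"
    if "i \<in> D" "Inv i (x # ys) a" for i x ys a
    using cs'(1)[of "(x, a, i)"] that by (auto simp: enc_pair_def)
  \<comment> \<open>Bounds one execution of the loop body: its argument consists of a list element
    (at most \<open>pl\<close>), the accumulator (at most \<open>q\<close>), the input and two
    pairing nodes.\<close>
  define pr where "pr = pcompose ps (pl + q + [:2, 1:])"
  let ?call = "call 3 2 (Cons_expr (Hd (Var 1)) (Cons_expr (Var 2) (Var 0))) cs"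
  let ?L = "Loop (Var 1) (Seq ?call (Assign 1 (Tl (Var 1))))"
  define S where "S i ys a = blank(0 := e i, 1 := enc_list g ys, 2 := h a)" for i ys a
  \<comment> \<open>Besides the body, an iteration costs 2 for the test, 6 + 5 for building the
    argument and calling, and 3 for advancing the list, hence 16. The leading 2 is the final,
    failing test.\<close>
  have loop: "runs ?L (S i ys a) (2 + length ys * (poly pr (size (e i)) + 16))
      (S i [] (fold (step i) ys a))"
    if "i \<in> D" "set ys \<subseteq> set (xs i)" "Inv i ys a" for i ys a
    using that
  proof (induction ys arbitrary: a)
    case Nil
    have "eval_expr (Var 1) (S i [] a) = Leaf" by (simp add: S_def)
    then show ?case using runs_mono[OF runs_Loop_false] by fastforce
  next
    case (Cons x ys)
    let ?n = "size (e i)"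
    have x: "x \<in> set (xs i)" using Cons.prems by simp
    have "size (g x) \<le> poly pl ?n"
      using size_enc_list_member[OF x, of g] cl(2)[OF Cons.prems(1)] by linarith
    then have sz: "poly ps (size (Node (g x) (Node (h a) (e i)))) \<le> poly pr ?n"
      unfolding pr_def poly_pcompose using Inv_size[OF Cons.prems(1,3)]
      by (intro poly_nat_mono) simp
    have 1: "runs ?call (S i (x # ys) a) (poly ps (size (Node (g x) (Node (h a) (e i)))) +
       (expr_cost (Cons_expr (Hd (Var 1)) (Cons_expr (Var 2) (Var 0))) + 5))
       ((S i (x # ys) a)(2 := h (step i x a)))"
      by (rule runs_call[OF cs[OF Cons.prems(1,3)]]) (auto simp: S_def)
    have "(S i (x # ys) a)(2 := h (step i x a), 1 := enc_list g ys) = S i ys (step i x a)"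
      by (auto simp: S_def fun_eq_iff)
    then have 2: "runs (Assign 1 (Tl (Var 1))) ((S i (x # ys) a)(2 := h (step i x a))) 3
        (S i ys (step i x a))"
      using runs_Assign[of 1 "Tl (Var 1)" "(S i (x # ys) a)(2 := h (step i x a))"]
      by (simp add: S_def numeral_3_eq_3)
    have 3: "runs ?L (S i ys (step i x a)) (2 + length ys * (poly pr ?n + 16))
       (S i [] (fold (step i) ys (step i x a)))"
      using Cons.prems by (intro Cons.IH Inv_step) auto
    have "eval_expr (Var 1) (S i (x # ys) a) \<noteq> Leaf" by (simp add: S_def)
    from runs_Loop_true[OF this runs_Seq[OF 1 2] 3] show ?case
      unfolding fold_simps(2) by (rule runs_mono) (use sz in simp)
  qed
  have Inv_fold: "Inv i [] (fold (step i) ys a)" if "i \<in> D" "Inv i ys a" for i ys a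
    using that by (induction ys arbitrary: a) (auto intro: Inv_step)
  let ?C = "Seq (call 3 1 (Var 0) cl) (Seq (call 3 2 (Var 0) ci)
     (Seq ?L (Seq (Assign 0 (Var 2)) (Assign 2 Atom))))"
  show ?thesis
  proof (rule ptimeI)
    fix i assume i: "i \<in> D"
    let ?n = "size (e i)" and ?r = "fold (step i) (xs i) (init i)"
    have 1: "runs (call 3 1 (Var 0) cl) (blank(0 := e i)) (poly pl ?n + (expr_cost (Var 0) + 5))
        ((blank(0 := e i))(1 := enc_list g (xs i)))"
      by (rule runs_call[OF cl(1)[OF i]]) auto
    have 2: "runs (call 3 2 (Var 0) ci) ((blank(0 := e i))(1 := enc_list g (xs i)))
        (poly pi ?n + (expr_cost (Var 0) + 5)) (S i (xs i) (init i))"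
      unfolding S_def by (rule runs_call[OF ci(1)[OF i]]) auto
    have 3: "runs ?L (S i (xs i) (init i)) (2 + length (xs i) * (poly pr ?n + 16)) (S i [] ?r)"
      by (rule loop[OF i _ Inv_init[OF i]]) simp
    have 4: "runs (Assign 0 (Var 2)) (S i [] ?r) 2 ((S i [] ?r)(0 := h ?r))"
      using runs_Assign[of 0 "Var 2" "S i [] ?r"] by (simp add: S_def numeral_2_eq_2)
    have "(S i [] ?r)(0 := h ?r, 2 := Leaf) = blank(0 := h ?r)"
      by (auto simp: S_def fun_eq_iff)
    then have 5: "runs (Assign 2 Atom) ((S i [] ?r)(0 := h ?r)) 2 (blank(0 := h ?r))"
      using runs_Assign[of 2 Atom "(S i [] ?r)(0 := h ?r)"] by (simp add: numeral_2_eq_2)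
    have "length (xs i) \<le> poly pl ?n"
      using length_le_size_enc_list cl(2)[OF i] order_trans by blast
    then have "length (xs i) * (poly pr ?n + 16) \<le> poly pl ?n * (poly pr ?n + 16)"
      by (rule mult_right_mono) simp
    then show "computes ?C (e i) (poly (pl + pi + [:18:] + pl * (pr + [:16:])) ?n) (h ?r)"
      unfolding computes_def
      by (intro runs_mono[OF runs_Seq[OF 1 runs_Seq[OF 2 runs_Seq[OF 3 runs_Seq[OF 4 5]]]]]) simp
    show "size (h ?r) \<le> poly q ?n"
      by (rule Inv_size[OF i Inv_fold[OF i Inv_init[OF i]]])
  qed
qed

lemma ptime_enc_pair:
  "ptime e D (\<lambda>i. g (a i)) \<Longrightarrow> ptime e D (\<lambda>i. h (b i)) \<Longrightarrow> ptime e D (\<lambda>i. enc_pair g h (a i, b i))"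
  unfolding enc_pair_def fst_conv snd_conv by (rule ptime_Node)

lemma ptime_fst: "ptime e D (\<lambda>i. enc_pair g h (a i)) \<Longrightarrow> ptime e D (\<lambda>i. g (fst (a i)))"
  by (drule ptime_val_fst) (simp add: enc_pair_def)

lemma ptime_snd: "ptime e D (\<lambda>i. enc_pair g h (a i)) \<Longrightarrow> ptime e D (\<lambda>i. h (snd (a i)))"
  by (drule ptime_val_snd) (simp add: enc_pair_def)

lemma ptime_arg1: "ptime (enc_pair g h) D (\<lambda>j. g (fst j))"
  by (rule ptime_fst[OF ptime_id[of "enc_pair g h"]])

lemma ptime_arg2: "ptime (enc_pair g h) D (\<lambda>j. h (snd j))"
  by (rule ptime_snd[OF ptime_id[of "enc_pair g h"]])

lemma ptime_arg1_fst: "ptime (enc_pair (enc_pair g g') h) D (\<lambda>j. g (fst (fst j)))"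
  by (rule ptime_fst) (rule ptime_arg1)

lemma ptime_arg1_snd: "ptime (enc_pair (enc_pair g g') h) D (\<lambda>j. g' (snd (fst j)))"
  by (rule ptime_snd) (rule ptime_arg1)

lemma ptime_arg2_fst: "ptime (enc_pair g (enc_pair h h')) D (\<lambda>j. h (fst (snd j)))"
  by (rule ptime_fst) (rule ptime_arg2)

lemma ptime_arg2_snd: "ptime (enc_pair g (enc_pair h h')) D (\<lambda>j. h' (snd (snd j)))"
  by (rule ptime_snd) (rule ptime_arg2)

text \<open>A loop body receives its bound values paired in front of the surrounding input, much
  like de Bruijn indices. Facts about the surrounding input are transported into the body by
  projecting it back out.\<close>

lemma ptime_weaken:
  assumes "ptime e D f" "\<And>j. j \<in> D' \<Longrightarrow> snd j \<in> D"
  shows "ptime (enc_pair g e) D' (\<lambda>j. f (snd j))"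
  by (rule ptime_comp[where e = e and \<phi> = snd, OF ptime_arg2 assms])

lemma ptime_weaken2:
  assumes "ptime e D f" "\<And>j. j \<in> D' \<Longrightarrow> snd (snd j) \<in> D"
  shows "ptime (enc_pair g (enc_pair h e)) D' (\<lambda>j. f (snd (snd j)))"
  by (rule ptime_comp[where e = e and \<phi> = "\<lambda>j. snd (snd j)", OF ptime_snd[OF ptime_arg2] assms])

lemma ptime_comp2:
  assumes "ptime (enc_pair g h) UNIV (\<lambda>j. f (fst j) (snd j))"
    and "ptime e D (\<lambda>i. g (a i))" "ptime e D (\<lambda>i. h (b i))"
  shows "ptime e D (\<lambda>i. f (a i) (b i))"
proof -
  have "ptime e D (\<lambda>i. enc_pair g h (a i, b i))"
    using assms(2,3) by (rule ptime_enc_pair)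
  from ptime_comp[OF this assms(1)] show ?thesis by simp
qed

lemma ptime_if_enc:
  assumes "ptime e D (\<lambda>i. enc_bool (P i))"
    and "ptime e {i \<in> D. P i} (\<lambda>i. h (a i))" "ptime e {i \<in> D. \<not> P i} (\<lambda>i. h (b i))"
  shows "ptime e D (\<lambda>i. h (if P i then a i else b i))"
  by (rule ptime_cong[OF ptime_if[OF assms]]) simp

lemma ptime_size_bound:
  assumes "ptime e D f"
  obtains q :: "nat poly" where "\<And>i. i \<in> D \<Longrightarrow> size (f i) \<le> poly q (size (e i))"
  using assms unfolding ptime_def by blast

lemma ptime_not: "ptime e D (\<lambda>i. enc_bool (P i)) \<Longrightarrow> ptime e D (\<lambda>i. enc_bool (\<not> P i))"
  by (rule ptime_cong[OF ptime_if[OF _ ptime_const[of _ _ Leaf] ptime_const[of _ _ "enc_bool True"]]])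
    auto

lemma ptime_conj:
  "ptime e D (\<lambda>i. enc_bool (P i)) \<Longrightarrow> ptime e {i \<in> D. P i} (\<lambda>i. enc_bool (Q i))
    \<Longrightarrow> ptime e D (\<lambda>i. enc_bool (P i \<and> Q i))"
  by (rule ptime_cong[OF ptime_if[OF _ _ ptime_const[of _ _ Leaf]]]) auto

lemma ptime_disj:
  "ptime e D (\<lambda>i. enc_bool (P i)) \<Longrightarrow> ptime e {i \<in> D. \<not> P i} (\<lambda>i. enc_bool (Q i))
    \<Longrightarrow> ptime e D (\<lambda>i. enc_bool (P i \<or> Q i))"
  by (rule ptime_cong[OF ptime_if[OF _ ptime_const[of _ _ "enc_bool True"]]]) auto

text \<open>This is the test built into the language. As \<open>[]\<close> is encoded by
  \<open>Leaf\<close>, it also serves as the emptiness test for lists.\<close>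

lemma ptime_not_Leaf:
  assumes "ptime e D f"
  shows "ptime e D (\<lambda>i. enc_bool (f i \<noteq> Leaf))"
proof -
  have "ptime id UNIV (\<lambda>d. enc_bool (d \<noteq> Leaf))"
  proof (rule ptimeI)
    let ?C = "Cond (Var 0) (Assign 0 (Cons_expr Atom Atom)) (Assign 0 Atom)"
    fix d
    have "runs ?C (blank(0 := d)) (expr_cost (Var 0) + 1 + 4) (blank(0 := enc_bool (d \<noteq> Leaf)))"
      using runs_Assign[of 0 "Cons_expr Atom Atom" "blank(0 := d)"]
        runs_Assign[of 0 Atom "blank(0 := d)"]
      by (intro runs_Cond) (auto intro: runs_mono)
    then show "computes ?C (id d) (poly [:6:] (size (id d))) (enc_bool (d \<noteq> Leaf))"
      unfolding computes_def by simp
    show "size (enc_bool (d \<noteq> Leaf)) \<le> poly [:1:] (size (id d))" by (cases "d = Leaf") auto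
  qed
  from ptime_comp[OF _ this, of e D f] assms show ?thesis by simp
qed

lemma ptime_bool_eq:
  assumes "ptime e D (\<lambda>i. enc_bool (P i))" "ptime e D (\<lambda>i. enc_bool (Q i))"
  shows "ptime e D (\<lambda>i. enc_bool (P i = Q i))"
proof -
  have "ptime e D (\<lambda>i. if P i then enc_bool (Q i) else enc_bool (\<not> Q i))"
    by (rule ptime_if[OF assms(1) ptime_subset[OF assms(2)] ptime_subset[OF ptime_not[OF assms(2)]]])
      auto
  then show ?thesis by (rule ptime_cong) auto
qed

text \<open>The form for loops whose invariant does not depend on how far the list has been
  processed; all that remains of the position is that the current element belongs to the
  list.\<close>

lemma ptime_fold_invariant:
  assumes list: "ptime e D (\<lambda>i. enc_list g (xs i))"
    and init: "ptime e D (\<lambda>i. h (init i))"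
    and step: "ptime (enc_pair g (enc_pair h e))
       {j. snd (snd j) \<in> D \<and> fst j \<in> set (xs (snd (snd j))) \<and> Inv (snd (snd j)) (fst (snd j))}
       (\<lambda>j. h (step (snd (snd j)) (fst j) (fst (snd j))))"
    and Inv_init: "\<And>i. i \<in> D \<Longrightarrow> Inv i (init i)"
    and Inv_step: "\<And>i x a. i \<in> D \<Longrightarrow> x \<in> set (xs i) \<Longrightarrow> Inv i a \<Longrightarrow> Inv i (step i x a)"
    and Inv_size: "\<And>i a. i \<in> D \<Longrightarrow> Inv i a \<Longrightarrow> size (h a) \<le> poly q (size (e i))"
  shows "ptime e D (\<lambda>i. h (fold (step i) (xs i) (init i)))"
proof (rule ptime_fold[where Inv = "\<lambda>i ys a. set ys \<subseteq> set (xs i) \<and> Inv i a", OF list init])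
  show "ptime (enc_pair g (enc_pair h e)) {j. snd (snd j) \<in> D \<and>
      (\<exists>ys. set (fst j # ys) \<subseteq> set (xs (snd (snd j))) \<and> Inv (snd (snd j)) (fst (snd j)))}
       (\<lambda>j. h (step (snd (snd j)) (fst j) (fst (snd j))))"
    by (rule ptime_subset[OF step]) auto
qed (use Inv_init Inv_step Inv_size in auto)

lemma ptime_ex:
  assumes list: "ptime e D (\<lambda>i. enc_list g (xs i))"
    and P: "ptime (enc_pair g e) {j. snd j \<in> D \<and> fst j \<in> set (xs (snd j))}
       (\<lambda>j. enc_bool (P (snd j) (fst j)))"
  shows "ptime e D (\<lambda>i. enc_bool (\<exists>x\<in>set (xs i). P i x))"
proof -
  let ?step = "\<lambda>i x a. a \<or> P i x"
  let ?e = "enc_pair g (enc_pair enc_bool e)"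
  let ?D = "{j. snd (snd j) \<in> D \<and> fst j \<in> set (xs (snd (snd j))) \<and> True}"
  have V: "ptime ?e D' ?e" for D' by (rule ptime_id)
  have "ptime e D (\<lambda>i. enc_bool (fold (?step i) (xs i) False))"
  proof (rule ptime_fold_invariant[where q = "[:1:]" and Inv = "\<lambda>_ _. True"
        and init = "\<lambda>_. False", OF list ptime_const])
    have "ptime ?e D' (\<lambda>j. enc_pair g e (fst j, snd (snd j)))" for D'
      by (rule ptime_enc_pair) (rule ptime_fst[OF V] ptime_snd[OF ptime_snd[OF V]])+
    from ptime_comp[OF this P, of "{j \<in> ?D. \<not> fst (snd j)}"]
    have "ptime ?e {j \<in> ?D. \<not> fst (snd j)} (\<lambda>j. enc_bool (P (snd (snd j)) (fst j)))" by auto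
    then show "ptime ?e ?D (\<lambda>j. enc_bool (fst (snd j) \<or> P (snd (snd j)) (fst j)))"
      by (rule ptime_disj[OF ptime_fst[OF ptime_snd[OF V]]])
    show "size (enc_bool b) \<le> poly [:1:] (size (e i))" for b i by (cases b) auto
  qed simp_all
  moreover have "fold (?step i) ys b = (b \<or> (\<exists>x\<in>set ys. P i x))" for i ys b
    by (induction ys arbitrary: b) auto
  ultimately show ?thesis by simp
qed

lemma ptime_all:
  assumes list: "ptime e D (\<lambda>i. enc_list g (xs i))"
    and P: "ptime (enc_pair g e) {j. snd j \<in> D \<and> fst j \<in> set (xs (snd j))}
       (\<lambda>j. enc_bool (P (snd j) (fst j)))"
  shows "ptime e D (\<lambda>i. enc_bool (\<forall>x\<in>set (xs i). P i x))"
  using ptime_not[OF ptime_ex[OF list ptime_not[OF P]]] by simp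

lemma size_enc_list_le:
  "(\<And>x. x \<in> set xs \<Longrightarrow> size (g x) \<le> m) \<Longrightarrow> size (enc_list g xs) \<le> length xs * (m + 1)"
proof (induction xs)
  case (Cons x xs)
  have "size (g x) \<le> m" "size (enc_list g xs) \<le> length xs * (m + 1)"
    using Cons by auto
  then show ?case by simp
qed simp

text \<open>Prepending to the accumulator reverses the order. The invariant must identify the
  accumulator with the result for the prefix already read, since otherwise nothing bounds the length
  of the accumulator.\<close>

lemma ptime_rev_map_filter:
  assumes list: "ptime e D (\<lambda>i. enc_list g (xs i))"
    and P: "ptime (enc_pair g e) {j. snd j \<in> D \<and> fst j \<in> set (xs (snd j))}
       (\<lambda>j. enc_bool (P (snd j) (fst j)))"
    and f: "ptime (enc_pair g e)
       {j. snd j \<in> D \<and> fst j \<in> set (xs (snd j)) \<and> P (snd j) (fst j)} (\<lambda>j. h (f (snd j) (fst j)))"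
  shows "ptime e D (\<lambda>i. enc_list h (rev (map (f i) (filter (P i) (xs i)))))"
proof -
  let ?step = "\<lambda>i x a. if P i x then f i x # a else a"
  let ?e = "enc_pair g (enc_pair (enc_list h) e)"
  define Inv where "Inv i ys a \<longleftrightarrow>
    (\<exists>us. xs i = us @ ys \<and> a = rev (map (f i) (filter (P i) us)))" for i ys a
  let ?D = "{j. snd (snd j) \<in> D \<and> (\<exists>ys. Inv (snd (snd j)) (fst j # ys) (fst (snd j)))}"
  have V: "ptime ?e D' ?e" for D' by (rule ptime_id)
  obtain cl and pl :: "nat poly" where
    pl: "\<And>i. i \<in> D \<Longrightarrow> computes cl (e i) (poly pl (size (e i))) (enc_list g (xs i))"
    "\<And>i. i \<in> D \<Longrightarrow> size (enc_list g (xs i)) \<le> poly pl (size (e i))"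
    using ptimeE[OF list] by blast
  let ?F = "{j. snd j \<in> D \<and> fst j \<in> set (xs (snd j)) \<and> P (snd j) (fst j)}"
  obtain cf and pf :: "nat poly" where
    pf: "\<And>j. j \<in> ?F \<Longrightarrow> computes cf (enc_pair g e j) (poly pf (size (enc_pair g e j)))
      (h (f (snd j) (fst j)))"
    "\<And>j. j \<in> ?F \<Longrightarrow> size (h (f (snd j) (fst j))) \<le> poly pf (size (enc_pair g e j))"
    using ptimeE[OF f] by blast
  \<comment> \<open>At most \<open>pl\<close> entries, each with one list node and a value bounded
    by \<open>pf\<close> at the size of its argument, which is an element, the input and one pairing
    node.\<close>
  define q where "q = pl * (pcompose pf (pl + [:1, 1:]) + [:1:])"
  have "ptime e D (\<lambda>i. enc_list h (fold (?step i) (xs i) []))"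
  proof (rule ptime_fold[where q = q and Inv = Inv and init = "\<lambda>_. []", OF list])
    show "ptime e D (\<lambda>i. enc_list h [])" unfolding enc_list.simps by (rule ptime_const)
    have arg: "ptime ?e D' (\<lambda>j. enc_pair g e (fst j, snd (snd j)))" for D'
      by (rule ptime_enc_pair) (rule ptime_fst[OF V] ptime_snd[OF ptime_snd[OF V]])+
    have "ptime ?e ?D (\<lambda>j. if P (snd (snd j)) (fst j)
        then Node (h (f (snd (snd j)) (fst j))) (enc_list h (fst (snd j))) else enc_list h (fst (snd j)))"
    proof (intro ptime_if ptime_Node)
      have sub: "fst j \<in> set (xs (snd (snd j)))" if "j \<in> ?D" for j
        using that by (auto simp: Inv_def)
      show "ptime ?e ?D (\<lambda>j. enc_bool (P (snd (snd j)) (fst j)))"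
        using ptime_comp[OF arg P, of ?D] sub by auto
      show "ptime ?e {j \<in> ?D. P (snd (snd j)) (fst j)} (\<lambda>j. h (f (snd (snd j)) (fst j)))"
        using ptime_comp[OF arg f, of "{j \<in> ?D. P (snd (snd j)) (fst j)}"] sub by auto
    qed (rule ptime_fst[OF ptime_snd[OF V]])+
    then show "ptime ?e ?D (\<lambda>j. enc_list h (?step (snd (snd j)) (fst j) (fst (snd j))))"
      by (rule ptime_cong) auto
    show "Inv i (xs i) []" for i by (simp add: Inv_def)
    show "Inv i ys (?step i x a)" if I: "Inv i (x # ys) a" for i x ys a
    proof -
      obtain us where us: "xs i = us @ x # ys" "a = rev (map (f i) (filter (P i) us))"
        using I unfolding Inv_def by blast
      then show ?thesis unfolding Inv_def by (intro exI[of _ "us @ [x]"]) auto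
    qed
    show "size (enc_list h a) \<le> poly q (size (e i))" if i: "i \<in> D" and I: "Inv i ys a" for i ys a
    proof -
      obtain us where us: "xs i = us @ ys" "a = rev (map (f i) (filter (P i) us))"
        using I unfolding Inv_def by blast
      let ?n = "size (e i)" and ?m = "poly (pcompose pf (pl + [:1, 1:])) (size (e i))"
      have "size (h (f i x)) \<le> ?m" if x: "x \<in> set us" "P i x" for x
      proof -
        have m: "x \<in> set (xs i)" using us x by simp
        have "size (enc_pair g e (x, i)) \<le> poly pl ?n + ?n + 1"
          using size_enc_list_member[OF m, of g] pl(2)[OF i] by (simp add: enc_pair_def)
        then have "poly pf (size (enc_pair g e (x, i))) \<le> ?m"
          unfolding poly_pcompose by (intro poly_nat_mono) simp
        then show ?thesis using pf(2)[of "(x, i)"] x m i by simp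
      qed
      then have "size (enc_list h a) \<le> length a * (?m + 1)"
        by (intro size_enc_list_le) (auto simp: us)
      moreover have "length a \<le> poly pl ?n"
        using us length_filter_le[of "P i" us, THEN order_trans, of "poly pl ?n"]
          length_le_size_enc_list[of "xs i" g] pl(2)[OF i]
        by simp
      ultimately show ?thesis
        unfolding q_def using mult_le_mono1[of "length a" "poly pl ?n" "?m + 1"] by simp
    qed
  qed
  moreover have "fold (?step i) ys a = rev (map (f i) (filter (P i) ys)) @ a" for i ys a
    by (induction ys arbitrary: a) auto
  ultimately show ?thesis by simp
qed

lemma ptime_rev:
  assumes "ptime e D (\<lambda>i. enc_list g (xs i))"
  shows "ptime e D (\<lambda>i. enc_list g (rev (xs i)))"
proof -
  have "ptime e D (\<lambda>i. enc_list g (rev (map (\<lambda>x. x) (filter (\<lambda>_. True) (xs i)))))"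
    by (rule ptime_rev_map_filter[where P = "\<lambda>_ _. True" and f = "\<lambda>_ x. x", OF assms])
      (rule ptime_const ptime_arg1)+
  then show ?thesis by simp
qed

lemma ptime_map_filter:
  assumes list: "ptime e D (\<lambda>i. enc_list g (xs i))"
    and P: "ptime (enc_pair g e) {j. snd j \<in> D \<and> fst j \<in> set (xs (snd j))}
       (\<lambda>j. enc_bool (P (snd j) (fst j)))"
    and f: "ptime (enc_pair g e)
       {j. snd j \<in> D \<and> fst j \<in> set (xs (snd j)) \<and> P (snd j) (fst j)} (\<lambda>j. h (f (snd j) (fst j)))"
  shows "ptime e D (\<lambda>i. enc_list h (map (f i) (filter (P i) (xs i))))"
proof -
  have "ptime e D (\<lambda>i. enc_list h (rev (map (f i) (filter (P i) (xs i)))))"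
    by (rule ptime_rev_map_filter[where f = f and P = P, OF list P f])
  from ptime_rev[OF this] show ?thesis by simp
qed

lemma ptime_filter:
  assumes list: "ptime e D (\<lambda>i. enc_list g (xs i))"
    and P: "ptime (enc_pair g e) {j. snd j \<in> D \<and> fst j \<in> set (xs (snd j))}
       (\<lambda>j. enc_bool (P (snd j) (fst j)))"
  shows "ptime e D (\<lambda>i. enc_list g (filter (P i) (xs i)))"
proof -
  have "ptime e D (\<lambda>i. enc_list g (map (\<lambda>x. x) (filter (P i) (xs i))))"
    by (rule ptime_map_filter[where P = P and f = "\<lambda>_ x. x", OF list P]) (rule ptime_arg1)
  then show ?thesis by simp
qed

lemma ptime_map:
  assumes list: "ptime e D (\<lambda>i. enc_list g (xs i))"
    and f: "ptime (enc_pair g e)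
       {j. snd j \<in> D \<and> fst j \<in> set (xs (snd j))} (\<lambda>j. h (f (snd j) (fst j)))"
  shows "ptime e D (\<lambda>i. enc_list h (map (f i) (xs i)))"
proof -
  have "ptime e D (\<lambda>i. enc_list h (map (f i) (filter (\<lambda>_. True) (xs i))))"
    by (rule ptime_map_filter[where P = "\<lambda>_ _. True" and f = f, OF list])
      (use f in \<open>simp_all add: ptime_const\<close>)
  then show ?thesis by simp
qed

section \<open>Comparison of binary numerals\<close>

fun nat_bits :: "nat \<Rightarrow> bool list" where
  "nat_bits n = (if n = 0 then [] else odd n # nat_bits (n div 2))"

declare nat_bits.simps [simp del]

text \<open>Turns a numeral into an encoded list, so that the list loops apply to it.\<close>

lemma enc_nat_eq_nat_bits: "enc_nat n = enc_list enc_bool (nat_bits n)"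
  by (induction n rule: nat_bits.induct) (subst enc_nat.simps, subst nat_bits.simps, simp)

lemma nat_bits_inject: "nat_bits m = nat_bits n \<longleftrightarrow> m = n"
proof
  show "nat_bits m = nat_bits n \<Longrightarrow> m = n"
  proof (induction m arbitrary: n rule: nat_bits.induct)
    case (1 m)
    show ?case
    proof (cases "m = 0 \<or> n = 0")
      case True
      then show ?thesis using 1(2) by (auto simp: nat_bits.simps[of m] nat_bits.simps[of n] split: if_splits)
    next
      case False
      then have "nat_bits (m div 2) = nat_bits (n div 2)" "odd m = odd n"
        using 1(2) by (auto simp: nat_bits.simps[of m] nat_bits.simps[of n])
      moreover have "m div 2 = n div 2" using 1(1) False calculation by auto
      ultimately show ?thesis by (metis bit_eq_rec)
    qed
  qed
qed simp

text \<open>A loop runs over one list only, so the second list travels in the accumulator and loses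
  its head in every round, next to a flag for agreement so far. Equality holds iff the flag survives
  and nothing of the second list is left.\<close>

lemma ptime_bools_eq:
  "ptime (enc_pair (enc_list enc_bool) (enc_list enc_bool)) UNIV (\<lambda>j. enc_bool (fst j = snd j))"
proof -
  let ?l = "enc_list enc_bool" and ?h = "enc_pair enc_bool (enc_list enc_bool)"
  let ?step = "\<lambda>b a. (fst a \<and> snd a \<noteq> [] \<and> b = hd (snd a), tl (snd a))"
  let ?e = "enc_pair enc_bool (enc_pair ?h (enc_pair ?l ?l))"
  let ?Inv = "\<lambda>i a. \<exists>n. snd a = drop n (snd i)"
  let ?D = "{j. snd (snd j) \<in> UNIV \<and> fst j \<in> set (fst (snd (snd j))) \<and>
      ?Inv (snd (snd j)) (fst (snd j))}"
  have ne: "(enc_list f l \<noteq> Leaf) = (l \<noteq> [])" for f :: "'x \<Rightarrow> val" and l by (cases l) auto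
  have V: "ptime (enc_pair ?l ?l) D' (enc_pair ?l ?l)" "ptime ?e D2 ?e" for D' D2 by (rule ptime_id)+
  have acc: "ptime ?e D' (\<lambda>j. ?l (snd (fst (snd j))))" for D'
    by (rule ptime_snd[OF ptime_fst[OF ptime_snd[OF V(2)]]])
  have tl: "ptime ?e D' (\<lambda>j. ?l (tl (snd (fst (snd j)))))" for D'
  proof (rule ptime_cong[OF ptime_val_snd[OF acc]])
    show "val_snd (?l (snd (fst (snd j)))) = ?l (tl (snd (fst (snd j))))"
      for j :: "bool \<times> (bool \<times> bool list) \<times> bool list \<times> bool list"
      by (cases "snd (fst (snd j))") auto
  qed
  have *: "ptime (enc_pair ?l ?l) UNIV (\<lambda>j. ?h (fold ?step (fst j) (True, snd j)))"
  proof (rule ptime_fold_invariant[where xs = fst and init = "\<lambda>j. (True, snd j)" and step = "\<lambda>_. ?step"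
        and Inv = ?Inv and q = "[:2, 1:]"])
    show "ptime (enc_pair ?l ?l) UNIV (\<lambda>j. ?l (fst j))" by (rule ptime_fst[OF V(1)])
    show "ptime (enc_pair ?l ?l) UNIV (\<lambda>j. ?h (True, snd j))"
      by (rule ptime_enc_pair) (rule ptime_const ptime_snd[OF V(1)])+
    show "ptime ?e ?D (\<lambda>j. ?h (?step (fst j) (fst (snd j))))"
    proof (intro ptime_enc_pair ptime_conj tl)
      show "ptime ?e ?D (\<lambda>j. enc_bool (fst (fst (snd j))))"
        by (rule ptime_fst[OF ptime_fst[OF ptime_snd[OF V(2)]]])
      show "ptime ?e D' (\<lambda>j. enc_bool (snd (fst (snd j)) \<noteq> []))" for D'
        using ptime_not_Leaf[OF acc] unfolding ne .
      \<comment> \<open>The restriction to nonempty remainders is essential: \<open>hd []\<close> is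
        unspecified, whereas the program would read \<open>Leaf\<close> there.\<close>
      have "ptime ?e {j \<in> D'. snd (fst (snd j)) \<noteq> []} (\<lambda>j. enc_bool (hd (snd (fst (snd j)))))" for D'
      proof (rule ptime_cong[OF ptime_val_fst[OF acc]])
        show "val_fst (?l (snd (fst (snd j)))) = enc_bool (hd (snd (fst (snd j))))"
          if "j \<in> {j \<in> D'. snd (fst (snd j)) \<noteq> []}"
          for j :: "bool \<times> (bool \<times> bool list) \<times> bool list \<times> bool list"
          using that by (cases "snd (fst (snd j))") auto
      qed
      then show "ptime ?e {j \<in> {j \<in> ?D. fst (fst (snd j))}. snd (fst (snd j)) \<noteq> []}
          (\<lambda>j. enc_bool (fst j = hd (snd (fst (snd j)))))"
        by (rule ptime_bool_eq[OF ptime_fst[OF V(2)]])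
    qed
    show "?Inv i (True, snd i)" for i :: "bool list \<times> bool list"
      by (rule exI[of _ 0]) simp
    show "?Inv i (?step x a)" if "?Inv i a" for i :: "bool list \<times> bool list" and x a
      using that by (auto simp: tl_drop drop_Suc[symmetric])
    show "size (?h a) \<le> poly [:2, 1:] (size (enc_pair ?l ?l i))" if "?Inv i a" for i a
    proof -
      have "size (?l (drop n ys)) \<le> size (?l ys)" for n ys
        by (induction ys arbitrary: n) (auto simp: drop_Cons le_SucI trans_le_add2 split: nat.split)
      moreover have "size (enc_bool b) \<le> 1" for b by (cases b) auto
      ultimately have "size (?l (snd a)) \<le> size (?l (snd i))" "size (enc_bool (fst a)) \<le> 1"
        using that by auto
      then show ?thesis by (simp add: enc_pair_def)
    qed
  qed
  have fold_eq: "fst (fold ?step xs (b, ys)) \<and> snd (fold ?step xs (b, ys)) = [] \<longleftrightarrow> b \<and> xs = ys" for xs ys b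
  proof (induction xs arbitrary: ys b)
    case (Cons x xs)
    then show ?case by (cases ys) auto
  qed auto
  have "ptime (enc_pair ?l ?l) UNIV (\<lambda>j. enc_bool (fst (fold ?step (fst j) (True, snd j)) \<and>
     \<not> snd (fold ?step (fst j) (True, snd j)) \<noteq> []))"
    using ptime_conj[OF ptime_fst[OF *]
        ptime_subset[OF ptime_not[OF ptime_not_Leaf[OF ptime_snd[OF *], unfolded ne]]]]
    by blast
  then show ?thesis
    by (rule ptime_cong) (rule arg_cong[where f = enc_bool], use fold_eq in blast)
qed

lemma ptime_nat_eq:
  assumes "ptime e D (\<lambda>i. enc_nat (a i))" "ptime e D (\<lambda>i. enc_nat (b i))"
  shows "ptime e D (\<lambda>i. enc_bool (a i = b i))"
  using ptime_comp2[OF ptime_bools_eq, of e D "\<lambda>i. nat_bits (a i)" "\<lambda>i. nat_bits (b i)"] assms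
  by (simp add: enc_nat_eq_nat_bits nat_bits_inject)

lemma ptime_nat_mem:
  assumes "ptime e D (\<lambda>i. enc_nat (a i))" "ptime e D (\<lambda>i. enc_list enc_nat (xs i))"
  shows "ptime e D (\<lambda>i. enc_bool (a i \<in> set (xs i)))"
proof -
  let ?e = "enc_pair enc_nat e"
  have V: "ptime ?e D' ?e" for D' by (rule ptime_id)
  have "ptime ?e {j. snd j \<in> D \<and> fst j \<in> set (xs (snd j))} (\<lambda>j. enc_nat (a (snd j)))"
    by (rule ptime_weaken[OF assms(1)]) simp
  from ptime_ex[OF assms(2) ptime_nat_eq[OF this ptime_fst[OF V]]]
  show ?thesis by (rule ptime_cong) auto
qed

section \<open>Blocks\<close>

text \<open>The closure is reflexive everywhere, also at points outside \<open>S\<close>; membership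
  of end points in \<open>S\<close> is therefore always demanded separately.\<close>

definition linked :: "'a rel \<Rightarrow> 'a set \<Rightarrow> 'a rel" where
  "linked E S = (E \<inter> S \<times> S)\<^sup>*"

definition connected_in :: "'a rel \<Rightarrow> 'a set \<Rightarrow> bool" where
  "connected_in E S \<longleftrightarrow> (\<forall>a\<in>S. \<forall>b\<in>S. (a, b) \<in> linked E S)"

text \<open>The empty set counts as connected here, so a single vertex needs no special treatment;
  nonemptiness is added when this is compared with \<open>nonseparable\<close>.\<close>

definition nonseparable_in :: "'a rel \<Rightarrow> 'a set \<Rightarrow> bool" where
  "nonseparable_in E S \<longleftrightarrow> connected_in E S \<and> (\<forall>x\<in>S. connected_in E (S - {x}))"

definition edge_block :: "'a set \<Rightarrow> 'a rel \<Rightarrow> 'a \<Rightarrow> 'a \<Rightarrow> 'a set" where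
  "edge_block V E u v =
     {w \<in> V. \<forall>x\<in>V. w = x \<or> (\<exists>t\<in>{u, v} - {x}. (t, w) \<in> linked E (V - {x}))}"

definition list_coloured :: "'a rel \<Rightarrow> ('a \<Rightarrow> nat set) \<Rightarrow> 'a set \<Rightarrow> ('a \<Rightarrow> nat) \<Rightarrow> bool" where
  "list_coloured E L S c \<longleftrightarrow> (\<forall>w\<in>S. c w \<in> L w) \<and> (\<forall>a\<in>S. \<forall>b\<in>S. (a, b) \<in> E \<longrightarrow> c a \<noteq> c b)"

lemma linked_mono: "E \<subseteq> E' \<Longrightarrow> S \<subseteq> T \<Longrightarrow> (a, b) \<in> linked E S \<Longrightarrow> (a, b) \<in> linked E' T"
  unfolding linked_def by (erule rtrancl_mono[THEN subsetD, rotated]) auto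

lemma linked_edge: "(a, b) \<in> E \<Longrightarrow> a \<in> S \<Longrightarrow> b \<in> S \<Longrightarrow> (a, b) \<in> linked E S"
  unfolding linked_def by blast

lemma linked_refl: "(a, a) \<in> linked E S"
  unfolding linked_def by blast

lemma linked_trans: "(a, b) \<in> linked E S \<Longrightarrow> (b, c) \<in> linked E S \<Longrightarrow> (a, c) \<in> linked E S"
  unfolding linked_def by (rule rtrancl_trans)

lemma linked_sym: "sym E \<Longrightarrow> (a, b) \<in> linked E S \<Longrightarrow> (b, a) \<in> linked E S"
  using sym_rtrancl[OF sym_Int, of E "S \<times> S"] unfolding linked_def by (auto simp: sym_def)

lemma connected_inI:
  assumes "sym E" "\<And>a. a \<in> S \<Longrightarrow> (a, t) \<in> linked E S"
  shows "connected_in E S"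
  unfolding connected_in_def using assms linked_sym linked_trans by metis

lemma connected_in_mono: "connected_in E S \<Longrightarrow> E \<subseteq> E' \<Longrightarrow> connected_in E' S"
  unfolding connected_in_def using linked_mono[of E E' S S] by blast

lemma nonseparable_in_mono: "nonseparable_in E S \<Longrightarrow> E \<subseteq> E' \<Longrightarrow> nonseparable_in E' S"
  unfolding nonseparable_in_def using connected_in_mono by blast

text \<open>A walk inside \<open>T\<close> that starts at \<open>z\<close> can never step from
  \<open>A\<close> to \<open>A'\<close>.\<close>

lemma connected_in_subset_cases:
  assumes "connected_in E T" "T \<subseteq> A \<union> A'" "\<And>a b. a \<in> A \<Longrightarrow> b \<in> A' \<Longrightarrow> (a, b) \<notin> E"
    and "z \<in> T" "z \<in> A" "A \<inter> A' = {}"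
  shows "T \<subseteq> A"
proof
  fix w assume w: "w \<in> T"
  have "(z, w) \<in> (E \<inter> T \<times> T)\<^sup>*"
    using assms(1,4) w unfolding connected_in_def linked_def by blast
  then show "w \<in> A"
  proof (induction rule: rtrancl_induct)
    case base
    show ?case by (rule assms(5))
  next
    case (step y w)
    then show ?case using assms(2,3) by blast
  qed
qed

lemma disconnected_split:
  assumes "\<not> connected_in E T" "sym E"
  obtains A A' where "T = A \<union> A'" "A \<inter> A' = {}" "A \<noteq> {}" "A' \<noteq> {}"
    "\<And>a b. a \<in> A \<Longrightarrow> b \<in> A' \<Longrightarrow> (a, b) \<notin> E \<and> (b, a) \<notin> E"
proof -
  obtain a b where ab: "a \<in> T" "b \<in> T" "(a, b) \<notin> linked E T"
    using assms unfolding connected_in_def by blast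
  let ?A = "{w \<in> T. (a, w) \<in> linked E T}"
  have "(x, y) \<notin> E" if "x \<in> ?A" "y \<in> T - ?A" for x y
    using that linked_edge[of x y E T] linked_trans[of a x E T y] by blast
  then have "(x, y) \<notin> E \<and> (y, x) \<notin> E" if "x \<in> ?A" "y \<in> T - ?A" for x y
    using that assms(2) by (meson symD)
  then show ?thesis using ab linked_refl[of a E T]
    by (intro that[of ?A "T - ?A"]) blast+
qed

text \<open>If the walk meets \<open>y\<close>, the part from there on is again a walk to
  \<open>b\<close>. The bound on its length is what makes the shortening argument for blocks
  terminate.\<close>

lemma relpow_avoid_or_visit:
  assumes "(a, b) \<in> R ^^ m" "a \<noteq> y"
  shows "b \<noteq> y \<and> (a, b) \<in> (R \<inter> (- {y}) \<times> (- {y}))\<^sup>* \<or> (\<exists>k\<le>m. (y, b) \<in> R ^^ k)"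
  using assms
proof (induction m arbitrary: a)
  case 0
  then show ?case by auto
next
  case (Suc m)
  obtain c where c: "(a, c) \<in> R" "(c, b) \<in> R ^^ m"
    using Suc.prems(1) by (meson relpow_Suc_D2)
  show ?case
  proof (cases "c = y")
    case True
    then show ?thesis using c(2) by (intro disjI2 exI[of _ m]) auto
  next
    case False
    from Suc.IH[OF c(2) this] show ?thesis
    proof
      assume "b \<noteq> y \<and> (c, b) \<in> (R \<inter> (- {y}) \<times> (- {y}))\<^sup>*"
      then show ?thesis using c(1) False Suc.prems(2)
        by (intro disjI1) (auto intro: converse_rtrancl_into_rtrancl)
    qed (meson le_SucI)
  qed
qed

locale finite_simple_edges =
  fixes V :: "'a set" and E :: "'a rel"
  assumes sym: "sym E" and irrefl: "\<And>a. (a, a) \<notin> E" and E_subset: "E \<subseteq> V \<times> V"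
begin

text \<open>
  If a walk leaves the block from \<open>w\<close> to \<open>w\<^sub>1\<close>, then the vertex separating \<open>w\<^sub>1\<close> from \<open>u\<close> and \<open>v\<close> can
  only be \<open>w\<close> itself, so the walk returns to \<open>w\<close> and can be shortened.
\<close>

lemma edge_block_walk:
  assumes "(w, t) \<in> (E \<inter> (V - {x}) \<times> (V - {x})) ^^ n" "w \<in> edge_block V E u v" "w \<noteq> x"
    and t: "t \<in> {u, v}"
  shows "(w, t) \<in> linked E (edge_block V E u v - {x})"
  using assms(1-3)
proof (induction n arbitrary: w rule: less_induct)
  case (less n)
  let ?B = "edge_block V E u v" and ?R = "E \<inter> (V - {x}) \<times> (V - {x})"
  show ?case
  proof (cases n)
    case 0
    then show ?thesis using less.prems(1) by (simp add: linked_refl)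
  next
    case (Suc m)
    then obtain w1 where w1: "(w, w1) \<in> ?R" "(w1, t) \<in> ?R ^^ m"
      using less.prems(1) by (meson relpow_Suc_D2)
    show ?thesis
    proof (cases "w1 \<in> ?B")
      case True
      then have "(w1, t) \<in> linked E (?B - {x})"
        using less.IH[of m w1] w1 Suc by auto
      moreover have "(w, w1) \<in> linked E (?B - {x})"
        using w1(1) True less.prems(2,3) by (intro linked_edge) auto
      ultimately show ?thesis using linked_trans by metis
    next
      case False
      then obtain y where y: "y \<in> V" "w1 \<noteq> y"
          "\<And>t'. t' \<in> {u, v} - {y} \<Longrightarrow> (t', w1) \<notin> linked E (V - {y})"
        using w1(1) unfolding edge_block_def by blast
      \<comment> \<open>Were \<open>w\<close> another vertex, then as a member of the block it would
        be reachable without \<open>y\<close>, and the edge to \<open>w1\<close> would carry this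
        reachability over to \<open>w1\<close>.\<close>
      have "w = y"
      proof (rule ccontr)
        assume "w \<noteq> y"
        then obtain t' where "t' \<in> {u, v} - {y}" "(t', w) \<in> linked E (V - {y})"
          using less.prems(2) y(1) unfolding edge_block_def by blast
        moreover have "(w, w1) \<in> linked E (V - {y})"
          using w1(1) \<open>w \<noteq> y\<close> y(2) by (intro linked_edge) auto
        ultimately show False using y(3) linked_trans by metis
      qed
      have "\<not> (t \<noteq> y \<and> (w1, t) \<in> (?R \<inter> (- {y}) \<times> (- {y}))\<^sup>*)"
      proof
        assume a: "t \<noteq> y \<and> (w1, t) \<in> (?R \<inter> (- {y}) \<times> (- {y}))\<^sup>*"
        have "?R \<inter> (- {y}) \<times> (- {y}) \<subseteq> E \<inter> (V - {y}) \<times> (V - {y})" by auto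
        then have "(w1, t) \<in> linked E (V - {y})"
          using a rtrancl_mono unfolding linked_def by blast
        then show False using y(3)[of t] a t linked_sym[OF sym] by blast
      qed
      then obtain k where "k \<le> m" "(w, t) \<in> ?R ^^ k"
        using relpow_avoid_or_visit[OF w1(2) y(2)] \<open>w = y\<close> by blast
      then show ?thesis using less.IH[of k w] less.prems(2,3) Suc by auto
    qed
  qed
qed

text \<open>The definition of the block speaks of walks through all of \<open>V - {x}\<close>.
  Nonseparability needs walks inside the block, and this provides them.\<close>

lemma edge_block_linked:
  assumes "w \<in> edge_block V E u v" "x \<in> V" "w \<noteq> x"
  obtains t where "t \<in> {u, v} - {x}" "(w, t) \<in> linked E (edge_block V E u v - {x})"
proof -
  obtain t where t: "t \<in> {u, v} - {x}" "(t, w) \<in> linked E (V - {x})"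
    using assms unfolding edge_block_def by blast
  then obtain n where "(w, t) \<in> (E \<inter> (V - {x}) \<times> (V - {x})) ^^ n"
    using linked_sym[OF sym t(2)] unfolding linked_def by (meson rtrancl_imp_relpow)
  from edge_block_walk[OF this assms(1,3)] t(1) show ?thesis using that by blast
qed

lemma edge_block_ends: "(u, v) \<in> E \<Longrightarrow> u \<in> edge_block V E u v \<and> v \<in> edge_block V E u v"
  using E_subset linked_refl unfolding edge_block_def by fastforce

lemma edge_block_subset: "edge_block V E u v \<subseteq> V"
  unfolding edge_block_def by blast

lemma nonseparable_edge_block:
  assumes uv: "(u, v) \<in> E"
  shows "nonseparable_in E (edge_block V E u v)"
  unfolding nonseparable_in_def
proof (intro conjI ballI)
  let ?B = "edge_block V E u v"
  have vu: "(v, u) \<in> E" and ends: "u \<in> ?B" "v \<in> ?B" and V: "u \<in> V"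
    using uv sym edge_block_ends[OF uv] E_subset by (auto dest: symD)
  show "connected_in E ?B"
  proof (rule connected_inI[OF sym])
    fix a assume a: "a \<in> ?B"
    show "(a, u) \<in> linked E ?B"
    proof (cases "a = u")
      case False
      then obtain t where t: "t \<in> {u, v} - {u}" "(a, t) \<in> linked E (?B - {u})"
        using edge_block_linked[OF a V] by blast
      then have "(a, v) \<in> linked E ?B" using linked_mono[of E E "?B - {u}" ?B] by auto
      then show ?thesis using linked_edge[OF vu] ends linked_trans by metis
    qed (simp add: linked_refl)
  qed
  fix x assume x: "x \<in> ?B"
  \<comment> \<open>An end of the edge that survives the removal of \<open>x\<close>. Every
    remaining vertex reaches some surviving end, and if both ends survive, the edge joins
    them.\<close>
  let ?s = "if x = u then v else u"
  show "connected_in E (?B - {x})"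
  proof (rule connected_inI[OF sym])
    fix a assume a: "a \<in> ?B - {x}"
    then obtain t where t: "t \<in> {u, v} - {x}" "(a, t) \<in> linked E (?B - {x})"
      using edge_block_linked[of a u v x] x edge_block_subset by blast
    have "(t, ?s) \<in> linked E (?B - {x})"
    proof (cases "t = ?s")
      case False
      then have "t = v" "?s = u" "x \<noteq> u" "x \<noteq> v" using t(1) by (auto split: if_splits)
      then show ?thesis using ends by (simp add: linked_edge[OF vu])
    qed (simp only: linked_refl)
    then show "(a, ?s) \<in> linked E (?B - {x})" using t(2) linked_trans by metis
  qed
qed

text \<open>The maximality half of being a block. A vertex \<open>x\<close> of \<open>T\<close> does
  not disconnect \<open>T\<close>, and a vertex outside \<open>T\<close> is avoided by all walks
  within \<open>T\<close>; either way \<open>w\<close> stays linked to an end of the edge.\<close>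

lemma nonseparable_subset_edge_block:
  assumes "nonseparable_in E T" "T \<subseteq> V" "u \<in> T" "v \<in> T" "u \<noteq> v"
  shows "T \<subseteq> edge_block V E u v"
proof
  fix w assume w: "w \<in> T"
  have "\<exists>t\<in>{u, v} - {x}. (t, w) \<in> linked E (V - {x})" if "x \<in> V" "w \<noteq> x" for x
  proof (cases "x \<in> T")
    case True
    obtain t where t: "t \<in> {u, v} - {x}" using assms(5) by (cases "x = u") auto
    then have "(t, w) \<in> linked E (T - {x})"
      using assms(1,3,4) True w that(2) unfolding nonseparable_in_def connected_in_def by blast
    then show ?thesis using t linked_mono[of E E "T - {x}" "V - {x}"] assms(2) by blast
  next
    case False
    then have "(u, w) \<in> linked E T" "u \<noteq> x"
      using assms(1,3) w unfolding nonseparable_in_def connected_in_def by auto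
    then show ?thesis using False linked_mono[of E E T "V - {x}"] assms(2) by blast
  qed
  then show "w \<in> edge_block V E u v" using w assms(2) unfolding edge_block_def by blast
qed

text \<open>The invariant under splitting. Blocks are always those of the whole graph, so what is
  known about them applies to every part unchanged and no blocks of subgraphs have to be
  considered.\<close>

definition block_closed :: "'a set \<Rightarrow> bool" where
  "block_closed S \<longleftrightarrow> (\<forall>a\<in>S. \<forall>b\<in>S. (a, b) \<in> E \<longrightarrow> edge_block V E a b \<subseteq> S)"

text \<open>A block stays connected without \<open>Y\<close>. As there are no loops, one end of the
  edge \<open>ab\<close> lies in \<open>A\<close> and not in \<open>Y\<close>, so the block minus
  \<open>Y\<close> is confined to \<open>A\<close>. Empty \<open>Y\<close> stands for a disconnected
  \<open>S\<close>, and \<open>{y}\<close> for a cut vertex.\<close>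

lemma block_closed_part:
  assumes S: "block_closed S" "S - Y = A \<union> A'" "A \<inter> A' = {}"
    and no: "\<And>a b. a \<in> A \<Longrightarrow> b \<in> A' \<Longrightarrow> (a, b) \<notin> E"
    and Y: "Y = {} \<or> Y = {y}" "Y \<subseteq> S"
  shows "block_closed (A \<union> Y)"
  unfolding block_closed_def
proof (intro ballI impI)
  fix a b assume ab: "a \<in> A \<union> Y" "b \<in> A \<union> Y" "(a, b) \<in> E"
  let ?B = "edge_block V E a b"
  have sub: "?B \<subseteq> S" using S(1,2) ab Y(2) unfolding block_closed_def by blast
  have "connected_in E (?B - Y)"
  proof (cases "Y \<inter> ?B = {}")
    case True
    then have "?B - Y = ?B" by blast
    then show ?thesis using nonseparable_edge_block[OF ab(3)] unfolding nonseparable_in_def by simp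
  next
    case False
    then show ?thesis using Y(1) nonseparable_edge_block[OF ab(3)] unfolding nonseparable_in_def by blast
  qed
  moreover obtain z where "z \<in> ?B - Y" "z \<in> A"
  proof (cases "a \<in> Y")
    case True
    then have "b \<notin> Y" using Y(1) irrefl ab(3) by blast
    then show ?thesis using that[of b] ab edge_block_ends[OF ab(3)] by blast
  next
    case False
    then show ?thesis using that[of a] ab edge_block_ends[OF ab(3)] by blast
  qed
  ultimately have "?B - Y \<subseteq> A"
    using connected_in_subset_cases[of E "?B - Y" A A' z] no S(2,3) sub by blast
  then show "?B \<subseteq> A \<union> Y" by blast
qed

lemma list_coloured_glue:
  assumes c1: "list_coloured E L (A \<union> Y) c1" and c2: "list_coloured E L (A' \<union> Y) c2"
    and agree: "\<And>y. y \<in> Y \<Longrightarrow> c1 y = c2 y"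
    and disj: "A \<inter> A' = {}" "Y \<inter> A' = {}"
    and no: "\<And>a b. a \<in> A \<Longrightarrow> b \<in> A' \<Longrightarrow> (a, b) \<notin> E \<and> (b, a) \<notin> E"
  shows "list_coloured E L (A \<union> A' \<union> Y) (\<lambda>w. if w \<in> A \<union> Y then c1 w else c2 w)"
proof -
  let ?c = "\<lambda>w. if w \<in> A \<union> Y then c1 w else c2 w"
  have 1: "?c w = c1 w" if "w \<in> A \<union> Y" for w using that by simp
  have 2: "?c w = c2 w" if "w \<in> A' \<union> Y" for w using that agree disj by auto
  show ?thesis
    unfolding list_coloured_def
  proof (intro conjI ballI impI)
    fix w assume "w \<in> A \<union> A' \<union> Y"
    then show "?c w \<in> L w" using c1 c2 1[of w] 2[of w] unfolding list_coloured_def by auto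
  next
    fix a b assume ab: "a \<in> A \<union> A' \<union> Y" "b \<in> A \<union> A' \<union> Y" "(a, b) \<in> E"
    then consider "a \<in> A \<union> Y" "b \<in> A \<union> Y" | "a \<in> A' \<union> Y" "b \<in> A' \<union> Y" using no by blast
    then show "?c a \<noteq> ?c b"
    proof cases
      case 1
      then show ?thesis using c1 ab(3) unfolding list_coloured_def by auto
    next
      case 2
      then have "c2 a \<noteq> c2 b" using c2 ab(3) unfolding list_coloured_def by blast
      then show ?thesis using 2 \<open>\<And>w. w \<in> A' \<union> Y \<Longrightarrow> ?c w = c2 w\<close> by metis
    qed
  qed
qed

text \<open>The colour of one vertex is prescribed to make the induction work: the second part has
  to be coloured with the colour that the cut vertex received in the first.\<close>

lemma list_coloured_extend:
  assumes blocks: "\<And>u v k. (u, v) \<in> E \<Longrightarrow> k \<in> L u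
      \<Longrightarrow> \<exists>c. list_coloured E L (edge_block V E u v) c \<and> c u = k"
    and ne: "\<And>w. w \<in> V \<Longrightarrow> L w \<noteq> {}"
    and "finite S" "S \<subseteq> V" "block_closed S" "x \<in> S" "k \<in> L x"
  shows "\<exists>c. list_coloured E L S c \<and> c x = k"
  using assms(3-)
proof (induction "card S" arbitrary: S x k rule: less_induct)
  case less
  show ?case
  proof (cases "nonseparable_in E S")
    case True
    show ?thesis
    proof (cases "S = {x}")
      case True
      have "list_coloured E L S (\<lambda>_. k)"
        unfolding list_coloured_def True using less.prems(5) irrefl by simp
      then show ?thesis by auto
    next
      case False
      then obtain z where "z \<in> S" "z \<noteq> x" using less.prems by blast
      then have "(x, z) \<in> (E \<inter> S \<times> S)\<^sup>*" "x \<noteq> z"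
        using True less.prems unfolding nonseparable_in_def connected_in_def linked_def by auto
      then obtain v where v: "(x, v) \<in> E" "v \<in> S" by (blast elim: converse_rtranclE)
      \<comment> \<open>A nonseparable closed set with at least two vertices is exactly one block:
        maximality gives one inclusion and \<open>block_closed\<close> the other.\<close>
      then have "S \<subseteq> edge_block V E x v"
        using nonseparable_subset_edge_block[OF True less.prems(2,4)] irrefl by blast
      moreover have "edge_block V E x v \<subseteq> S"
        using less.prems v unfolding block_closed_def by blast
      ultimately show ?thesis using blocks[OF v(1) less.prems(5)] by simp
    qed
  next
    case False
    \<comment> \<open>Treats a disconnected \<open>S\<close> and a cut vertex of \<open>S\<close>
      alike.\<close>
    then have "\<exists>Y y. (Y = {} \<or> Y = {y}) \<and> Y \<subseteq> S \<and> \<not> connected_in E (S - Y)"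
      unfolding nonseparable_in_def by (metis Diff_empty empty_subsetI empty_iff insert_subset)
    then obtain Y y where Y: "Y = {} \<or> Y = {y}" "Y \<subseteq> S" "\<not> connected_in E (S - Y)"
      by blast
    \<comment> \<open>Stated for arbitrary \<open>A\<close> and \<open>A'\<close> because the side
      that contains \<open>x\<close> has to be coloured first, and that may be either of
      them.\<close>
    have main: ?thesis
      if sp: "S - Y = A \<union> A'" "A \<inter> A' = {}" "A \<noteq> {}" "A' \<noteq> {}" "x \<in> A \<union> Y"
        and no: "\<And>a b. a \<in> A \<Longrightarrow> b \<in> A' \<Longrightarrow> (a, b) \<notin> E \<and> (b, a) \<notin> E" for A A'
    proof -
      have S: "S = A \<union> A' \<union> Y" "Y \<inter> A' = {}" "Y \<inter> A = {}" using sp Y by blast+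
      have 1: "finite (A \<union> Y)" "A \<union> Y \<subseteq> V" "card (A \<union> Y) < card S"
        using S sp less.prems(1,2) by (auto intro!: psubset_card_mono)
      have 2: "finite (A' \<union> Y)" "A' \<union> Y \<subseteq> V" "card (A' \<union> Y) < card S"
        using S sp less.prems(1,2) by (auto intro!: psubset_card_mono)
      have bc1: "block_closed (A \<union> Y)"
        using block_closed_part[OF less.prems(3) sp(1,2) _ Y(1,2)] no by blast
      have bc2: "block_closed (A' \<union> Y)"
        using block_closed_part[OF less.prems(3), of Y A' A y] sp(1,2) no Y(1,2) by blast
      obtain c1 where c1: "list_coloured E L (A \<union> Y) c1" "c1 x = k"
        using less.hyps[OF 1(3,1,2) bc1 sp(5) less.prems(5)] by blast
      have "\<exists>c2. list_coloured E L (A' \<union> Y) c2 \<and> (\<forall>z\<in>Y. c1 z = c2 z)"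
      proof (cases "Y = {}")
        case True
        \<comment> \<open>There is no colour to match, but the induction hypothesis still wants a
          vertex with a prescribed colour; any will do, as the lists are nonempty.\<close>
        obtain z where z: "z \<in> A'" using sp by blast
        then obtain k' where "k' \<in> L z" using ne 2(2) by blast
        then show ?thesis using less.hyps[OF 2(3,1,2) bc2, of z k'] z True by blast
      next
        case False
        then have y: "Y = {y}" using Y(1) by blast
        then have "c1 y \<in> L y" using c1 unfolding list_coloured_def by blast
        then show ?thesis using less.hyps[OF 2(3,1,2) bc2, of y "c1 y"] y by auto
      qed
      then obtain c2 where c2: "list_coloured E L (A' \<union> Y) c2" "\<And>z. z \<in> Y \<Longrightarrow> c1 z = c2 z"
        by blast
      show ?thesis
        using list_coloured_glue[OF c1(1) c2 sp(2) S(2) no] c1(2) sp(5) S(1)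
        by (intro exI[of _ "\<lambda>w. if w \<in> A \<union> Y then c1 w else c2 w"]) simp
    qed
    obtain A A' where A: "S - Y = A \<union> A'" "A \<inter> A' = {}" "A \<noteq> {}" "A' \<noteq> {}"
        "\<And>a b. a \<in> A \<Longrightarrow> b \<in> A' \<Longrightarrow> (a, b) \<notin> E \<and> (b, a) \<notin> E"
      using disconnected_split[OF Y(3) sym] by metis
    show ?thesis
    proof (cases "x \<in> A \<union> Y")
      case True
      then show ?thesis using main[of A A'] A by blast
    next
      case False
      then have "x \<in> A' \<union> Y" using A(1) less.prems(4) by blast
      then show ?thesis using main[of A' A] A by blast
    qed
  qed
qed

lemma list_coloured_if_blocks:
  assumes "finite V"
    and blocks: "\<And>u v k. (u, v) \<in> E \<Longrightarrow> k \<in> L u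
      \<Longrightarrow> \<exists>c. list_coloured E L (edge_block V E u v) c \<and> c u = k"
    and ne: "\<And>w. w \<in> V \<Longrightarrow> L w \<noteq> {}"
  shows "\<exists>c. list_coloured E L V c"
proof (cases "V = {}")
  case False
  then obtain x k where "x \<in> V" "k \<in> L x" using ne by blast
  moreover have "block_closed V" unfolding block_closed_def using edge_block_subset by blast
  ultimately have "\<exists>c. list_coloured E L V c \<and> c x = k"
    by (intro list_coloured_extend[OF blocks ne assms(1)]) auto
  then show ?thesis by blast
qed (simp add: list_coloured_def)

end

section \<open>Agreement with the graph library's notions\<close>

lemma rtrancl_on_eq_linked: "a \<in> S \<Longrightarrow> (a, b) \<in> rtrancl_on S E \<longleftrightarrow> (a, b) \<in> linked E S"
proof
  assume "(a, b) \<in> rtrancl_on S E"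
  then show "(a, b) \<in> linked E S"
    unfolding linked_def by (induction rule: rtrancl_on_induct) (auto intro: rtrancl_into_rtrancl)
next
  assume "a \<in> S" "(a, b) \<in> linked E S"
  from this(2) show "(a, b) \<in> rtrancl_on S E"
    unfolding linked_def
    by (induction rule: rtrancl_induct) (auto intro: rtrancl_on_into_rtrancl_on \<open>a \<in> S\<close>)
qed

lemma (in sym_digraph) connected_iff_connected_in:
  "connected G \<longleftrightarrow> verts G \<noteq> {} \<and> connected_in (arcs_ends G) (verts G)"
proof -
  have "parcs (mk_symmetric G) = arcs_ends G" by (rule adj_mk_symmetric_eq[OF sym_arcs])
  then show ?thesis
    unfolding connected_def strongly_connected_def reachable_def connected_in_def
    by (simp add: rtrancl_on_eq_linked)
qed

lemma linked_restrict: "linked (E \<inter> T \<times> T) S = linked E (S \<inter> T)"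
  unfolding linked_def by (rule arg_cong[where f = rtrancl]) blast

lemma (in sym_digraph) connected_del_vert:
  "connected (del_vert x) \<longleftrightarrow> verts G - {x} \<noteq> {} \<and> connected_in (arcs_ends G) (verts G - {x})"
proof -
  have ends: "arcs_ends (del_vert x) = arcs_ends G \<inter> (- {x}) \<times> (- {x})"
    by (auto simp: arcs_ends_conv del_vert_simps)
  have "sym (arcs_ends G)" using sym_arcs unfolding symmetric_def .
  then have "sym (arcs_ends (del_vert x))" unfolding ends by (auto simp: sym_def)
  then interpret D: sym_digraph "del_vert x"
    using wf_digraph_del_vert by (simp add: sym_digraph_def sym_digraph_axioms_def symmetric_def)
  have "(verts G - {x}) \<inter> - {x} = verts G - {x}" by blast
  then show ?thesis
    unfolding D.connected_iff_connected_in ends connected_in_def linked_restrict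
    by (simp add: verts_del_vert)
qed

lemma nonseparable_iff_nonseparable_in:
  assumes "graph H"
  shows "nonseparable H \<longleftrightarrow> verts H \<noteq> {} \<and> nonseparable_in (arcs_ends H) (verts H)"
proof -
  interpret graph H by fact
  have "connected_in (arcs_ends H) {}" by (simp add: connected_in_def)
  then show ?thesis
    unfolding nonseparable_def nonseparable_in_def connected_iff_connected_in connected_del_vert
    using assms by auto
qed

lemma (in pair_graph) finite_simple_edges: "finite_simple_edges (pverts G) (parcs G)"
proof
  show "sym (parcs G)" using sym_arcs unfolding symmetric_def by simp
  show "(a, a) \<notin> parcs G" for a using pair_no_loops[of "(a, a)"] by auto
  show "parcs G \<subseteq> pverts G \<times> pverts G" using wellformed' by auto
qed

text \<open>Justifies sending the queries to the solver. Maximality is required among all subgraphs,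
  not only induced ones: the vertex set of a larger candidate is bounded first, and then its arcs
  are forced.\<close>

lemma (in pair_graph) is_block_edge_block:
  assumes uv: "(u, v) \<in> parcs G"
  defines "B \<equiv> edge_block (pverts G) (parcs G) u v"
  shows "is_block \<lparr>pverts = B, parcs = parcs G \<inter> B \<times> B\<rparr> G"
proof -
  interpret F: finite_simple_edges "pverts G" "parcs G" by (rule finite_simple_edges)
  let ?H = "\<lparr>pverts = B, parcs = parcs G \<inter> B \<times> B\<rparr>"
  have B: "B \<subseteq> pverts G" "u \<in> B" "v \<in> B" "nonseparable_in (parcs G) B" "u \<noteq> v"
    using F.edge_block_subset F.edge_block_ends[OF uv] F.nonseparable_edge_block[OF uv] uv F.irrefl
    unfolding B_def by auto
  have "pair_graph ?H"
  proof
    show "finite (pverts ?H)" using finite_subset[OF B(1) pair_finite_verts] by simp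
    show "finite (parcs ?H)" using pair_finite_arcs by simp
    show "symmetric ?H" using F.sym unfolding symmetric_def by (auto simp: sym_def)
  qed (use F.irrefl in auto)
  then interpret H: pair_graph ?H .
  have gH: "graph (with_proj ?H)" by unfold_locales
  have ns: "nonseparable_in (parcs G \<inter> B \<times> B) B"
  proof -
    have "B \<inter> B = B" "(B - {x}) \<inter> B = B - {x}" for x by auto
    then show ?thesis
      using B(4) unfolding nonseparable_in_def connected_in_def linked_restrict by simp
  qed
  have nH: "nonseparable (with_proj ?H)"
    unfolding nonseparable_iff_nonseparable_in[OF gH] using ns B by auto
  show ?thesis
    unfolding is_block_def pre_digraph.max_subgraph_def
  proof (intro conjI allI impI notI)
    show sub: "subgraph (with_proj ?H) (with_proj G)"
      unfolding subgraph_def using B(1) H.wf_digraph wf_digraph by auto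
    show "nonseparable (with_proj ?H)" by (rule nH)
    fix H' assume H': "H' \<noteq> with_proj ?H \<and> subgraph (with_proj ?H) H'"
      "subgraph H' (with_proj G) \<and> nonseparable H'"
    then have gH': "graph H'" unfolding nonseparable_def by blast
    then interpret H': graph H' .
    have proj: "tail H' = fst" "head H' = snd" and V: "verts H' \<subseteq> pverts G" "B \<subseteq> verts H'"
      and A: "arcs H' \<subseteq> parcs G" "parcs G \<inter> B \<times> B \<subseteq> arcs H'"
      using H' unfolding subgraph_def compatible_def by auto
    have ends: "arcs_ends H' = arcs H'" unfolding arcs_ends_conv proj by auto
    \<comment> \<open>A candidate may lack arcs of the graph, but restoring arcs preserves
      nonseparability, so the bound for vertex sets applies.\<close>
    have "nonseparable_in (parcs G) (verts H')"
      using H'(2) A(1) nonseparable_in_mono unfolding nonseparable_iff_nonseparable_in[OF gH'] ends by blast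
    then have "verts H' \<subseteq> B"
      unfolding B_def using V B by (intro F.nonseparable_subset_edge_block) auto
    then have vB: "verts H' = B" using V by blast
    have "arcs H' \<subseteq> B \<times> B"
      using H'.wellformed unfolding proj vB by (auto simp: mem_Times_iff)
    then have "arcs H' = parcs G \<inter> B \<times> B" using A by blast
    then have "H' = with_proj ?H" using vB proj by (auto simp: with_proj_def)
    then show False using H' by blast
  qed
qed

section \<open>Computing blocks\<close>

text \<open>A list whose entries are ignored acts as a unary counter; this is how a fixed number of
  repetitions is expressed by a fold.\<close>

lemma fold_const_eq_funpow: "fold (\<lambda>_. f) xs a = (f ^^ length xs) a"
  by (induction xs arbitrary: a) (simp_all add: funpow_swap1)

text \<open>Until a fixpoint is reached every step lowers \<open>m\<close>, and from then on nothing
  changes. Hence the number of iterations can be chosen beforehand, and no test for stability is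
  programmed.\<close>

lemma funpow_reaches_fixpoint:
  fixes m :: "'a \<Rightarrow> nat"
  assumes "\<And>a. I a \<Longrightarrow> I (f a)" "\<And>a. I a \<Longrightarrow> f a = a \<or> m (f a) < m a"
    and "I a" "m a \<le> n"
  shows "f ((f ^^ n) a) = (f ^^ n) a"
  using assms(3,4)
proof (induction n arbitrary: a)
  case 0
  then show ?case using assms(2)[OF 0(1)] by simp
next
  case (Suc n)
  show ?case
  proof (cases "f a = a")
    case True
    have "(f ^^ k) a = a" for k by (induction k) (simp_all add: True)
    then show ?thesis using True by simp
  next
    case False
    then have "m (f a) \<le> n" using assms(2)[OF Suc.prems(1)] Suc.prems(2) by simp
    then show ?thesis using Suc.IH[OF assms(1)[OF Suc.prems(1)]] by (simp add: funpow_swap1)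
  qed
qed

text \<open>Any change during a pass lowers \<open>m\<close> and cannot be undone later in the pass.
  So a pass without net effect shows that each of its single steps has no effect.\<close>

lemma fold_fixpoint_or_decreases:
  fixes m :: "'a \<Rightarrow> nat"
  assumes "\<And>p a. p \<in> set ps \<Longrightarrow> I a \<Longrightarrow> I (f p a) \<and> (f p a = a \<or> m (f p a) < m a)" "I a"
  shows "I (fold f ps a) \<and>
    (fold f ps a = a \<and> (\<forall>p\<in>set ps. f p a = a) \<or> m (fold f ps a) < m a)"
  using assms
proof (induction ps arbitrary: a)
  case (Cons p ps)
  have p: "I (f p a)" "f p a = a \<or> m (f p a) < m a"
    using Cons.prems by auto
  have "I (fold f ps (f p a)) \<and>
      (fold f ps (f p a) = f p a \<and> (\<forall>p'\<in>set ps. f p' (f p a) = f p a)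
        \<or> m (fold f ps (f p a)) < m (f p a))"
    by (rule Cons.IH) (use Cons.prems p in auto)
  then show ?case using p(2) by auto
qed simp

text \<open>The reached set is always produced by filtering \<open>vs\<close>. This bounds its code
  by that of \<open>vs\<close> and gives every set a single list form.\<close>

definition reach_step :: "nat \<Rightarrow> nat list \<Rightarrow> (nat \<times> nat) list \<Rightarrow> nat list \<Rightarrow> nat list" where
  "reach_step x vs es R =
     filter (\<lambda>w. w \<in> set R \<or> w \<noteq> x \<and> (\<exists>p\<in>set es. snd p = w \<and> fst p \<in> set R)) vs"

definition reach_list :: "nat \<Rightarrow> nat \<Rightarrow> nat \<Rightarrow> nat list \<Rightarrow> (nat \<times> nat) list \<Rightarrow> nat list" where
  "reach_list u v x vs es =
     fold (\<lambda>_. reach_step x vs es) vs (filter (\<lambda>w. w \<noteq> x \<and> (w = u \<or> w = v)) vs)"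

definition block_list :: "nat \<Rightarrow> nat \<Rightarrow> nat list \<Rightarrow> (nat \<times> nat) list \<Rightarrow> nat list" where
  "block_list u v vs es =
     filter (\<lambda>w. \<forall>x\<in>set vs. w = x \<or> w \<in> set (reach_list u v x vs es)) vs"

lemma set_reach_list:
  assumes E: "set es \<subseteq> set vs \<times> set vs" and uv: "u \<in> set vs" "v \<in> set vs"
  shows "set (reach_list u v x vs es)
    = {w. \<exists>t\<in>{u, v} - {x}. (t, w) \<in> linked (set es) (set vs - {x})}"
proof
  let ?V = "set vs - {x}" and ?f = "reach_step x vs es"
  let ?S = "filter (\<lambda>w. w \<noteq> x \<and> (w = u \<or> w = v)) vs"
  \<comment> \<open>Lists in this form are determined by their sets, so a step that adds no vertex
    fixes the list itself.\<close>
  let ?I = "\<lambda>R. R = filter (\<lambda>w. w \<in> set R) vs"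
  let ?R = "(?f ^^ length vs) ?S"
  have R: "reach_list u v x vs es = ?R"
    unfolding reach_list_def fold_const_eq_funpow ..
  have "set ((?f ^^ n) ?S) \<subseteq> {w \<in> ?V. \<exists>t\<in>{u, v} - {x}. (t, w) \<in> linked (set es) ?V}" for n
  proof (induction n)
    case 0
    have "set ?S \<subseteq> {w \<in> ?V. \<exists>t\<in>{u, v} - {x}. (t, w) \<in> linked (set es) ?V}"
      by clarsimp (metis Diff_iff insertCI linked_refl singletonD)
    then show ?case by simp
  next
    case (Suc n)
    show ?case
    proof
      fix w assume "w \<in> set ((?f ^^ Suc n) ?S)"
      then have w: "w \<in> set vs" and "w \<in> set ((?f ^^ n) ?S) \<or>
          w \<noteq> x \<and> (\<exists>a. (a, w) \<in> set es \<and> a \<in> set ((?f ^^ n) ?S))"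
        by (auto simp: reach_step_def)
      then show "w \<in> {w \<in> ?V. \<exists>t\<in>{u, v} - {x}. (t, w) \<in> linked (set es) ?V}"
      proof (elim disjE conjE exE)
        fix a assume a: "w \<noteq> x" "(a, w) \<in> set es" "a \<in> set ((?f ^^ n) ?S)"
        then obtain t where t: "t \<in> {u, v} - {x}" "(t, a) \<in> linked (set es) ?V" "a \<in> ?V"
          using Suc by blast
        have "(a, w) \<in> linked (set es) ?V"
          using a w t(3) by (intro linked_edge) auto
        with t(2) have "(t, w) \<in> linked (set es) ?V" by (rule linked_trans)
        then show ?thesis using w a(1) t(1) by blast
      qed (use Suc in blast)
    qed
  qed
  then show "set (reach_list u v x vs es)
      \<subseteq> {w. \<exists>t\<in>{u, v} - {x}. (t, w) \<in> linked (set es) (set vs - {x})}"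
    unfolding R by blast
  have I_filter: "?I (filter P vs)" for P by (rule filter_cong) auto
  have I_step: "?I (?f R)" for R unfolding reach_step_def by (rule I_filter)
  have mono: "set R \<subseteq> set (?f R)" if "?I R" for R
    using arg_cong[OF that, of set] by (auto simp: reach_step_def)
  \<comment> \<open>The measure is the number of vertices not yet reached, so
    \<open>length vs\<close> rounds are enough.\<close>
  have fixpoint: "?f ?R = ?R"
  proof (rule funpow_reaches_fixpoint[where I = ?I and m = "\<lambda>R. card (set vs - set R)"])
    show "?I (?f R)" for R by (rule I_step)
    show "?f R = R \<or> card (set vs - set (?f R)) < card (set vs - set R)" if R: "?I R" for R
    proof (cases "set (?f R) = set R")
      case True
      then have "?f R = R" using R I_step[of R] by simp
      then show ?thesis ..
    next
      case False
      moreover have "set (?f R) \<subseteq> set vs" by (auto simp: reach_step_def)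
      ultimately have "set vs - set (?f R) \<subset> set vs - set R" using mono[OF R] by blast
      then show ?thesis by (simp add: psubset_card_mono)
    qed
    show "?I ?S" by (rule I_filter)
    show "card (set vs - set ?S) \<le> length vs"
      using card_mono[of "set vs" "set vs - set ?S"] card_length[of vs] by auto
  qed
  have start: "t \<in> set ((?f ^^ n) ?S)" if "t \<in> {u, v} - {x}" for t n
  proof (induction n)
    case 0
    show ?case using that uv by simp blast
  next
    case (Suc n)
    have "?I ((?f ^^ n) ?S)"
    proof (cases n)
      case 0
      show ?thesis unfolding 0 funpow_0 by (rule I_filter)
    next
      case (Suc m)
      show ?thesis unfolding Suc funpow.simps o_apply by (rule I_step)
    qed
    from mono[OF this] Suc show ?case by (simp add: subset_iff)
  qed
  show "{w. \<exists>t\<in>{u, v} - {x}. (t, w) \<in> linked (set es) (set vs - {x})}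
      \<subseteq> set (reach_list u v x vs es)"
  proof
    fix w assume "w \<in> {w. \<exists>t\<in>{u, v} - {x}. (t, w) \<in> linked (set es) ?V}"
    then obtain t where t: "(t, w) \<in> linked (set es) ?V" "t \<in> {u, v} - {x}" by blast
    from t(1) show "w \<in> set (reach_list u v x vs es)"
      unfolding R linked_def
    proof (induction rule: rtrancl_induct)
      case base
      show ?case by (rule start[OF t(2)])
    next
      case (step a w)
      then have "w \<in> set vs" "w \<noteq> x" "\<exists>p\<in>set es. snd p = w \<and> fst p \<in> set ?R"
        by (auto intro!: bexI[of _ "(a, w)"])
      then have "w \<in> set (?f ?R)" unfolding reach_step_def[of x vs es ?R] by simp
      then show ?case using fixpoint by simp
    qed
  qed
qed

lemma set_block_list:
  assumes "set es \<subseteq> set vs \<times> set vs" "u \<in> set vs" "v \<in> set vs"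
  shows "set (block_list u v vs es) = edge_block (set vs) (set es) u v"
  unfolding block_list_def edge_block_def set_reach_list[OF assms] by auto

section \<open>The pruning algorithm\<close>

type_synonym instance_lists = "(nat \<times> nat list) list"
type_synonym lc_instance = "instance_lists \<times> (nat \<times> nat) list"

definition inst_graph :: "lc_instance \<Rightarrow> nat pair_pre_digraph" where
  "inst_graph i = \<lparr>pverts = set (map fst (fst i)), parcs = set (snd i)\<rparr>"

definition inst_lists :: "instance_lists \<Rightarrow> nat \<Rightarrow> nat set" where
  "inst_lists vcs w = {k. \<exists>q\<in>set vcs. fst q = w \<and> k \<in> set (snd q)}"

definition inst_yes :: "lc_instance \<Rightarrow> bool" where
  "inst_yes i \<longleftrightarrow> (\<exists>c. colouring (inst_graph i) c \<and>
     respects_lists (inst_graph i) (inst_lists (fst i)) c)"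

definition valid_inst :: "lc_instance \<Rightarrow> bool" where
  "valid_inst i \<longleftrightarrow> distinct (map fst (fst i)) \<and> distinct (snd i) \<and>
     (\<forall>q\<in>set (fst i). distinct (snd q) \<and> 0 \<notin> set (snd q))"

definition instances :: "nat pair_pre_digraph set \<Rightarrow> lc_instance set" where
  "instances \<G> = {i. valid_inst i \<and> inst_graph i \<in> \<G>}"

definition block_inst :: "nat \<times> nat \<Rightarrow> nat \<Rightarrow> lc_instance \<Rightarrow> lc_instance" where
  "block_inst p k i =
     (let B = set (block_list (fst p) (snd p) (map fst (fst i)) (snd i)) in
      (map (\<lambda>q. (fst q, if fst q = fst p then [k] else snd q)) (filter (\<lambda>q. fst q \<in> B) (fst i)),
       filter (\<lambda>a. fst a \<in> B \<and> snd a \<in> B) (snd i)))"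

definition prune :: "(nat \<times> nat) list \<Rightarrow> nat \<times> nat \<Rightarrow> instance_lists \<Rightarrow> instance_lists" where
  "prune es p vcs = map (\<lambda>q. (fst q, if fst q = fst p
     then filter (\<lambda>k. inst_yes (block_inst p k (vcs, es))) (snd q) else snd q)) vcs"

definition prune_round :: "(nat \<times> nat) list \<Rightarrow> instance_lists \<Rightarrow> instance_lists" where
  "prune_round es = fold (prune es) es"

text \<open>One round per colour in the lists, so that the lists have become stable at the end.\<close>

definition prune_all :: "lc_instance \<Rightarrow> instance_lists" where
  "prune_all i = fold (\<lambda>q. fold (\<lambda>_. prune_round (snd i)) (snd q)) (fst i) (fst i)"

text \<open>Filtering, rather than mere inclusion of sets, preserves distinctness and the order of
  the vertices and bounds the size of the code.\<close>

definition shrinks :: "instance_lists \<Rightarrow> instance_lists \<Rightarrow> bool" where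
  "shrinks = list_all2 (\<lambda>q q'. fst q = fst q' \<and> (\<exists>P. snd q = filter P (snd q')))"

lemma shrinks_refl: "shrinks a a"
  unfolding shrinks_def by (rule list_all2_refl) (auto intro: exI[of _ "\<lambda>_. True"])

lemma shrinks_trans:
  assumes "shrinks a b" "shrinks b c"
  shows "shrinks a c"
  unfolding shrinks_def
proof (rule list_all2_trans[OF _ assms[unfolded shrinks_def]])
  show "fst q = fst q'' \<and> (\<exists>P. snd q = filter P (snd q''))"
    if "fst q = fst q' \<and> (\<exists>P. snd q = filter P (snd q'))"
      "fst q' = fst q'' \<and> (\<exists>P. snd q' = filter P (snd q''))"
    for q q' q'' :: "nat \<times> nat list"
    using that filter_filter by metis
qed

lemma shrinks_map_fst: "shrinks a b \<Longrightarrow> map fst a = map fst b"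
  unfolding shrinks_def by (induction rule: list_all2_induct) auto

lemma shrinks_valid_inst: assumes "shrinks a b" "valid_inst (b, es)" shows "valid_inst (a, es)"
proof -
  have "(\<forall>q\<in>set b. distinct (snd q) \<and> 0 \<notin> set (snd q))
      \<Longrightarrow> (\<forall>q\<in>set a. distinct (snd q) \<and> 0 \<notin> set (snd q))"
    using assms(1) unfolding shrinks_def by (induction rule: list_all2_induct) auto
  then show ?thesis using assms(2) shrinks_map_fst[OF assms(1)] by (simp add: valid_inst_def)
qed

lemma shrinks_inst_lists: "shrinks a b \<Longrightarrow> inst_lists a w \<subseteq> inst_lists b w"
  unfolding shrinks_def
proof (induction rule: list_all2_induct)
  case (Cons q a q' b)
  have "inst_lists (x # xs) w = (if fst x = w then set (snd x) else {}) \<union> inst_lists xs w" for x xs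
    by (cases x) (auto simp: inst_lists_def)
  then show ?case using Cons by auto
qed simp

lemma shrinks_inst_graph: "shrinks a b \<Longrightarrow> inst_graph (a, es) = inst_graph (b, es)"
  unfolding inst_graph_def by (simp add: shrinks_map_fst del: set_map)

lemma shrinks_prune: "shrinks (prune es p a) a"
  unfolding shrinks_def prune_def list_all2_map1
  by (rule list_all2_refl) (auto intro: exI[of _ "\<lambda>_. True"])

definition total_colours :: "instance_lists \<Rightarrow> nat" where
  "total_colours vcs = sum_list (map (length \<circ> snd) vcs)"

lemma map_fixpoint_or_decreases:
  assumes "\<And>q. q \<in> set a \<Longrightarrow> g q = q \<or> length (snd (g q)) < length (snd q)"
  shows "map g a = a \<or> total_colours (map g a) < total_colours a"
  using assms
proof (induction a)
  case (Cons q a)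
  have "map g a = a \<or> total_colours (map g a) < total_colours a" using Cons by simp
  moreover have "g q = q \<or> length (snd (g q)) < length (snd q)" using Cons.prems by simp
  ultimately show ?case by (cases "map g a = a"; cases "g q = q") (simp_all add: total_colours_def)
qed simp

lemma prune_fixpoint_or_decreases:
  "prune es p a = a \<or> total_colours (prune es p a) < total_colours a"
  unfolding prune_def
proof (rule map_fixpoint_or_decreases)
  fix q :: "nat \<times> nat list"
  let ?P = "\<lambda>k. inst_yes (block_inst p k (a, es))"
  have "filter ?P (snd q) = snd q \<or> length (filter ?P (snd q)) < length (snd q)"
    by (metis filter_id_conv length_filter_less)
  then show "(fst q, if fst q = fst p then filter ?P (snd q) else snd q) = q \<or>
      length (snd (fst q, if fst q = fst p then filter ?P (snd q) else snd q)) < length (snd q)"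
    by (cases q) auto
qed

lemma prune_round_properties:
  "shrinks (prune_round es a) a \<and>
    (prune_round es a = a \<and> (\<forall>p\<in>set es. prune es p a = a)
      \<or> total_colours (prune_round es a) < total_colours a)"
  unfolding prune_round_def
  by (rule fold_fixpoint_or_decreases[where I = "\<lambda>b. shrinks b a"])
    (use shrinks_refl shrinks_trans shrinks_prune prune_fixpoint_or_decreases in blast)+

text \<open>The nested folds only count. They run over the original lists, so the count is not
  affected by the colours deleted on the way.\<close>

lemma prune_all_eq_funpow:
  "prune_all i = (prune_round (snd i) ^^ total_colours (fst i)) (fst i)"
proof -
  have "fold (\<lambda>q. fold (\<lambda>_. f) (snd q)) vcs a = (f ^^ total_colours vcs) a"
    for f :: "instance_lists \<Rightarrow> instance_lists" and vcs :: instance_lists and a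
  proof (induction vcs arbitrary: a)
    case (Cons q vcs)
    have "(f ^^ total_colours (q # vcs)) a = (f ^^ (total_colours vcs + length (snd q))) a"
      by (simp add: total_colours_def add.commute)
    then show ?case using Cons by (simp add: fold_const_eq_funpow funpow_add)
  qed (simp add: total_colours_def)
  then show ?thesis by (simp add: prune_all_def)
qed

lemma prune_all_stable: "p \<in> set (snd i) \<Longrightarrow> prune (snd i) p (prune_all i) = prune_all i"
proof -
  let ?f = "prune_round (snd i)"
  have "?f (prune_all i) = prune_all i"
    unfolding prune_all_eq_funpow
    by (rule funpow_reaches_fixpoint[where I = "\<lambda>_. True" and m = total_colours])
      (use prune_round_properties in blast)+
  then show "p \<in> set (snd i) \<Longrightarrow> ?thesis"
    using prune_round_properties[of "snd i" "prune_all i"] by auto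
qed

lemma list_coloured_subset: "list_coloured E L T c \<Longrightarrow> S \<subseteq> T \<Longrightarrow> list_coloured E L S c"
  unfolding list_coloured_def by (simp add: subset_iff)

lemma inst_lists_nonzero:
  assumes "valid_inst i" "k \<in> inst_lists (fst i) w"
  shows "k \<noteq> 0"
proof -
  obtain q where q: "q \<in> set (fst i)" "k \<in> set (snd q)"
    using assms(2) unfolding inst_lists_def by blast
  then have "0 \<notin> set (snd q)" using assms(1) unfolding valid_inst_def by blast
  then show ?thesis using q(2) by (intro notI) simp
qed

lemma inst_yes_iff_list_coloured:
  assumes "valid_inst i" "set (snd i) \<subseteq> fst ` set (fst i) \<times> fst ` set (fst i)"
  shows "inst_yes i \<longleftrightarrow>
    (\<exists>c. list_coloured (set (snd i)) (inst_lists (fst i)) (fst ` set (fst i)) c)"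
proof -
  have "1 \<le> k" if "k \<in> inst_lists (fst i) w" for k w
    using inst_lists_nonzero[OF assms(1) that] by simp
  then have "colouring (inst_graph i) c \<and> respects_lists (inst_graph i) (inst_lists (fst i)) c \<longleftrightarrow>
      list_coloured (set (snd i)) (inst_lists (fst i)) (fst ` set (fst i)) c" for c
    using assms(2) unfolding colouring_def respects_lists_def list_coloured_def inst_graph_def
    by auto blast+
  then show ?thesis unfolding inst_yes_def by simp
qed

lemma inst_lists_fst:
  assumes "distinct (map fst vcs)" "q \<in> set vcs"
  shows "inst_lists vcs (fst q) = set (snd q)"
proof -
  have "q' = q" if "q' \<in> set vcs" "fst q' = fst q" for q'
    using assms that unfolding distinct_map by (meson inj_onD)
  then show ?thesis using assms(2) unfolding inst_lists_def by blast
qed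

lemma inst_lists_nonempty_iff:
  assumes "distinct (map fst vcs)"
  shows "(\<forall>q\<in>set vcs. snd q \<noteq> []) \<longleftrightarrow> (\<forall>w\<in>fst ` set vcs. inst_lists vcs w \<noteq> {})"
proof -
  have "inst_lists vcs (fst q) = set (snd q)" if "q \<in> set vcs" for q
    using assms that by (rule inst_lists_fst)
  then show ?thesis by auto
qed

lemma inst_lists_map:
  "inst_lists (map (\<lambda>q. (fst q, h q)) vcs) w = {k. \<exists>q\<in>set vcs. fst q = w \<and> k \<in> set (h q)}"
  unfolding inst_lists_def by simp

lemma inst_lists_prune:
  "inst_lists (prune es p a) w =
     {k \<in> inst_lists a w. w = fst p \<longrightarrow> inst_yes (block_inst p k (a, es))}"
proof -
  let ?P = "\<lambda>k. inst_yes (block_inst p k (a, es))"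
  have "fst q = w \<and> k \<in> set (if fst q = fst p then filter ?P (snd q) else snd q) \<longleftrightarrow>
      (w = fst p \<longrightarrow> ?P k) \<and> fst q = w \<and> k \<in> set (snd q)" for k q
    by auto
  then show ?thesis
    unfolding prune_def inst_lists_map unfolding inst_lists_def by (simp only: bex_simps) blast
qed

lemma inst_lists_map_filter:
  fixes vcs :: instance_lists
  assumes "w \<in> B"
  shows "inst_lists (map (\<lambda>q. (fst q, h q)) (filter (\<lambda>q. fst q \<in> B) vcs)) w
    = {k. \<exists>q\<in>set vcs. fst q = w \<and> k \<in> set (h q)}"
proof -
  have "(\<exists>q\<in>{q \<in> A. fst q \<in> B}. fst q = w \<and> R q) \<longleftrightarrow> (\<exists>q\<in>A. fst q = w \<and> R q)"
    for R and A :: "(nat \<times> nat list) set"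
  proof
    assume "\<exists>q\<in>A. fst q = w \<and> R q"
    then obtain q where "q \<in> A" "fst q = w" "R q" by blast
    then show "\<exists>q\<in>{q \<in> A. fst q \<in> B}. fst q = w \<and> R q"
      using assms by (intro bexI[of _ q]) simp_all
  qed blast
  then show ?thesis unfolding inst_lists_map set_filter by (simp only:)
qed

section \<open>Soundness and completeness of pruning at an arc\<close>

context
  fixes i :: lc_instance
  assumes valid: "valid_inst i" and graph: "pair_graph (inst_graph i)"
begin

interpretation pair_graph "inst_graph i" by (rule graph)

interpretation F: finite_simple_edges "fst ` set (fst i)" "set (snd i)"
  using finite_simple_edges by (simp add: inst_graph_def)

lemma set_block_list_inst:
  assumes "p \<in> set (snd i)"
  shows "set (block_list (fst p) (snd p) (map fst (fst i)) (snd i))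
    = edge_block (fst ` set (fst i)) (set (snd i)) (fst p) (snd p)"
proof -
  have "p \<in> fst ` set (fst i) \<times> fst ` set (fst i)"
    using F.E_subset assms by (rule subsetD)
  then have "fst p \<in> fst ` set (fst i)" "snd p \<in> fst ` set (fst i)"
    by (simp_all only: mem_Times_iff)
  then show ?thesis
    using set_block_list[of "snd i" "map fst (fst i)" "fst p" "snd p"] F.E_subset by simp
qed

lemma block_inst_graph:
  assumes "p \<in> set (snd i)"
  defines "B \<equiv> edge_block (fst ` set (fst i)) (set (snd i)) (fst p) (snd p)"
  shows "inst_graph (block_inst p k i) = \<lparr>pverts = B, parcs = set (snd i) \<inter> B \<times> B\<rparr>"
proof -
  have "B \<subseteq> fst ` set (fst i)" unfolding B_def by (rule F.edge_block_subset)
  then have "fst ` {q \<in> set (fst i). fst q \<in> B} = B" by blast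
  moreover have "{a \<in> set (snd i). fst a \<in> B \<and> snd a \<in> B} = set (snd i) \<inter> B \<times> B"
    by (auto simp: mem_Times_iff)
  ultimately show ?thesis
    unfolding inst_graph_def block_inst_def set_block_list_inst[OF assms(1)] B_def[symmetric]
    by (simp add: Let_def image_image)
qed

lemma block_inst_is_block:
  assumes "p \<in> set (snd i)"
  shows "is_block (inst_graph (block_inst p k i)) (inst_graph i)"
  using is_block_edge_block[of "fst p" "snd p"] assms unfolding block_inst_graph[OF assms]
  by (simp add: inst_graph_def)

lemma valid_block_inst: "k \<noteq> 0 \<Longrightarrow> valid_inst (block_inst p k i)"
  using valid unfolding valid_inst_def block_inst_def
  by (simp add: Let_def comp_def distinct_map_filter del: split_paired_All)

lemma inst_lists_block_inst:
  assumes "p \<in> set (snd i)"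
    and w: "w \<in> edge_block (fst ` set (fst i)) (set (snd i)) (fst p) (snd p)"
  shows "inst_lists (fst (block_inst p k i)) w = (if w = fst p then {k} else inst_lists (fst i) w)"
proof -
  have ex: "\<exists>q\<in>set (fst i). fst q = w" using w F.edge_block_subset by blast
  have "inst_lists (fst (block_inst p k i)) w =
      {k'. \<exists>q\<in>set (fst i). fst q = w \<and> k' \<in> set (if fst q = fst p then [k] else snd q)}"
    unfolding block_inst_def set_block_list_inst[OF assms(1)] Let_def fst_conv
    by (rule inst_lists_map_filter[OF w])
  also have "\<dots> = {k'. \<exists>q\<in>set (fst i). fst q = w \<and> k' \<in> set (if w = fst p then [k] else snd q)}"
    by metis
  also have "\<dots> = (if w = fst p then {k} else inst_lists (fst i) w)"
    using ex unfolding inst_lists_def by (cases "w = fst p") simp_all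
  finally show ?thesis .
qed

text \<open>Translates the solver's answer into the hypothesis of the gluing argument. As
  \<open>k\<close> belongs to the list of \<open>fst p\<close>, passing to \<open>[k]\<close> only
  restricts that list.\<close>

lemma inst_yes_block_inst:
  assumes p: "p \<in> set (snd i)" and k: "k \<in> inst_lists (fst i) (fst p)"
  defines "B \<equiv> edge_block (fst ` set (fst i)) (set (snd i)) (fst p) (snd p)"
  shows "inst_yes (block_inst p k i) \<longleftrightarrow>
    (\<exists>c. list_coloured (set (snd i)) (inst_lists (fst i)) B c \<and> c (fst p) = k)"
proof -
  let ?b = "block_inst p k i"
  have g: "fst ` set (fst ?b) = B" "set (snd ?b) = set (snd i) \<inter> B \<times> B"
    using block_inst_graph[OF p, of k] unfolding B_def[symmetric] inst_graph_def by auto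
  have "k \<noteq> 0" using inst_lists_nonzero[OF valid k] .
  then have "inst_yes ?b \<longleftrightarrow>
      (\<exists>c. list_coloured (set (snd i) \<inter> B \<times> B) (inst_lists (fst ?b)) B c)"
    using inst_yes_iff_list_coloured[OF valid_block_inst, of k p] unfolding g by blast
  moreover have "list_coloured (set (snd i) \<inter> B \<times> B) (inst_lists (fst ?b)) B c \<longleftrightarrow>
      list_coloured (set (snd i)) (inst_lists (fst i)) B c \<and> c (fst p) = k" for c
  proof -
    have "fst p \<in> B" using F.edge_block_ends[of "fst p" "snd p"] p unfolding B_def by simp
    moreover have "inst_lists (fst ?b) w = (if w = fst p then {k} else inst_lists (fst i) w)"
      if "w \<in> B" for w using inst_lists_block_inst[OF p] that unfolding B_def by blast
    ultimately show ?thesis using k unfolding list_coloured_def by (auto split: if_splits)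
  qed
  ultimately show ?thesis by simp
qed

text \<open>The restriction of \<open>c\<close> to the block witnesses a positive answer for the
  colour \<open>c (fst p)\<close>, so that colour is kept.\<close>

lemma list_coloured_prune:
  assumes "p \<in> set (snd i)"
    and c: "list_coloured (set (snd i)) (inst_lists (fst i)) (fst ` set (fst i)) c"
  shows "list_coloured (set (snd i)) (inst_lists (prune (snd i) p (fst i))) (fst ` set (fst i)) c"
proof -
  let ?B = "edge_block (fst ` set (fst i)) (set (snd i)) (fst p) (snd p)"
  have B: "?B \<subseteq> fst ` set (fst i)" by (rule F.edge_block_subset)
  have "fst p \<in> ?B" using F.edge_block_ends[of "fst p" "snd p"] assms(1) by simp
  then have "c (fst p) \<in> inst_lists (fst i) (fst p)" using B c unfolding list_coloured_def by blast
  moreover have "list_coloured (set (snd i)) (inst_lists (fst i)) ?B c"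
    using c B by (rule list_coloured_subset)
  ultimately have "inst_yes (block_inst p (c (fst p)) i)"
    using inst_yes_block_inst[OF assms(1)] by blast
  then show ?thesis using c unfolding list_coloured_def inst_lists_prune by simp
qed

text \<open>Stability means that every query about a remaining colour was answered positively, which
  is the condition on blocks in \<open>list_coloured_if_blocks\<close>.\<close>

lemma inst_yes_if_stable:
  assumes stable: "\<And>p. p \<in> set (snd i) \<Longrightarrow> prune (snd i) p (fst i) = fst i"
    and ne: "\<forall>q\<in>set (fst i). snd q \<noteq> []"
  shows "inst_yes i"
proof -
  have "\<exists>c. list_coloured (set (snd i)) (inst_lists (fst i)) (fst ` set (fst i)) c"
  proof (rule F.list_coloured_if_blocks)
    fix u v k assume uv: "(u, v) \<in> set (snd i)" and k: "k \<in> inst_lists (fst i) u"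
    have "k \<in> inst_lists (prune (snd i) (u, v) (fst i)) u" using stable[OF uv] k by simp
    then have "inst_yes (block_inst (u, v) k i)" unfolding inst_lists_prune by simp
    then show "\<exists>c. list_coloured (set (snd i)) (inst_lists (fst i))
        (edge_block (fst ` set (fst i)) (set (snd i)) u v) c \<and> c u = k"
      using inst_yes_block_inst[OF uv] k by simp
  next
    show "inst_lists (fst i) w \<noteq> {}" if "w \<in> fst ` set (fst i)" for w
      using that ne inst_lists_nonempty_iff[of "fst i"] valid unfolding valid_inst_def by blast
  qed simp
  then show ?thesis using inst_yes_iff_list_coloured[OF valid F.E_subset] by blast
qed

end

lemma prune_all_induct:
  assumes "Q (fst i)" "\<And>p a. p \<in> set (snd i) \<Longrightarrow> Q a \<Longrightarrow> Q (prune (snd i) p a)"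
  shows "Q (prune_all i)"
proof -
  have "Q (fold (prune (snd i)) ps a)" if "set ps \<subseteq> set (snd i)" "Q a" for ps a
    using that
  proof (induction ps arbitrary: a)
    case (Cons p ps)
    then show ?case using assms(2)[of p a] by simp
  qed simp
  then have round: "Q (prune_round (snd i) a)" if "Q a" for a
    using that unfolding prune_round_def by blast
  have "Q ((prune_round (snd i) ^^ n) (fst i))" for n
    by (induction n) (simp_all add: assms(1) round)
  then show ?thesis by (simp add: prune_all_eq_funpow)
qed

lemma prune_all_correct:
  assumes valid: "valid_inst i" and graph: "pair_graph (inst_graph i)"
  shows "inst_yes i \<longleftrightarrow> (\<forall>q\<in>set (prune_all i). snd q \<noteq> [])"
proof -
  let ?E = "set (snd i)" and ?V = "fst ` set (fst i)" and ?r = "prune_all i"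
  have E: "?E \<subseteq> ?V \<times> ?V"
    using pair_graph.finite_simple_edges[OF graph] unfolding finite_simple_edges_def inst_graph_def
    by simp
  have inv: "valid_inst (a, snd i) \<and> pair_graph (inst_graph (a, snd i)) \<and> fst ` set a = ?V"
    if "shrinks a (fst i)" for a
    using shrinks_valid_inst[OF that] shrinks_inst_graph[OF that, of "snd i"] valid graph
      arg_cong[OF shrinks_map_fst[OF that], of set] by simp
  have shr: "shrinks ?r (fst i)"
    by (rule prune_all_induct) (auto intro: shrinks_refl shrinks_trans[OF shrinks_prune])
  note r = inv[OF shr]
  show ?thesis
  proof
    assume "inst_yes i"
    then obtain c where c: "list_coloured ?E (inst_lists (fst i)) ?V c"
      using inst_yes_iff_list_coloured[OF valid E] by blast
    \<comment> \<open>\<open>shrinks\<close> is carried along because each pruning step needs the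
      intermediate instance to be valid and to have the same graph.\<close>
    have "shrinks ?r (fst i) \<and> list_coloured ?E (inst_lists ?r) ?V c"
    proof (rule prune_all_induct)
      fix p a assume p: "p \<in> ?E" and a: "shrinks a (fst i) \<and> list_coloured ?E (inst_lists a) ?V c"
      then have "list_coloured ?E (inst_lists (prune (snd i) p a)) ?V c"
        using list_coloured_prune[of "(a, snd i)" p c] inv[of a] by auto
      then show "shrinks (prune (snd i) p a) (fst i) \<and>
          list_coloured ?E (inst_lists (prune (snd i) p a)) ?V c"
        using a shrinks_trans[OF shrinks_prune] by blast
    qed (use c shrinks_refl in auto)
    then have "\<forall>w\<in>?V. inst_lists ?r w \<noteq> {}" unfolding list_coloured_def by blast
    then show "\<forall>q\<in>set ?r. snd q \<noteq> []"
      using inst_lists_nonempty_iff[of ?r] r unfolding valid_inst_def by auto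
  next
    assume "\<forall>q\<in>set ?r. snd q \<noteq> []"
    then have "inst_yes (?r, snd i)"
      using inst_yes_if_stable[of "(?r, snd i)"] r prune_all_stable[of _ i] by auto
    then obtain c where "list_coloured ?E (inst_lists ?r) ?V c"
      using inst_yes_iff_list_coloured[of "(?r, snd i)"] r E by auto
    then have "list_coloured ?E (inst_lists (fst i)) ?V c"
      using shrinks_inst_lists[OF shr] unfolding list_coloured_def by blast
    then show "inst_yes i" using inst_yes_iff_list_coloured[OF valid E] by blast
  qed
qed

section \<open>Running time\<close>

abbreviation enc_nats :: "nat list \<Rightarrow> val" where
  "enc_nats \<equiv> enc_list enc_nat"

abbreviation enc_arcs :: "(nat \<times> nat) list \<Rightarrow> val" where
  "enc_arcs \<equiv> enc_list (enc_pair enc_nat enc_nat)"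

abbreviation enc_lists :: "instance_lists \<Rightarrow> val" where
  "enc_lists \<equiv> enc_list (enc_pair enc_nat enc_nats)"

abbreviation enc_inst :: "lc_instance \<Rightarrow> val" where
  "enc_inst \<equiv> enc_pair enc_lists enc_arcs"

lemmas ptime_logic = ptime_disj ptime_conj ptime_not ptime_nat_eq ptime_nat_mem
lemmas ptime_args = ptime_arg1 ptime_arg1_fst ptime_arg1_snd ptime_arg2_fst ptime_arg2_snd

lemma size_enc_list_filter: "size (enc_list g (filter P xs)) \<le> size (enc_list g xs)"
  by (induction xs) auto

lemma ptime_reach_step:
  assumes x: "ptime e D (\<lambda>i. enc_nat (x i))" and vs: "ptime e D (\<lambda>i. enc_nats (vs i))"
    and es: "ptime e D (\<lambda>i. enc_arcs (es i))" and R: "ptime e D (\<lambda>i. enc_nats (R i))"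
  shows "ptime e D (\<lambda>i. enc_nats (reach_step (x i) (vs i) (es i) (R i)))"
  unfolding reach_step_def
  by (rule ptime_filter[OF vs])
    \<comment> \<open>The goals follow the syntax of the filter condition; the weakening rules reach
      through one or two binders, and \<open>simp\<close> settles the side conditions on
      domains.\<close>
    (rule ptime_logic ptime_ex[OF ptime_weaken[OF es]] ptime_args ptime_weaken[OF x]
      ptime_weaken[OF R] ptime_weaken2[OF R] | simp)+

lemma ptime_reach_list:
  assumes u: "ptime e D (\<lambda>i. enc_nat (u i))" and v: "ptime e D (\<lambda>i. enc_nat (v i))"
    and x: "ptime e D (\<lambda>i. enc_nat (x i))" and vs: "ptime e D (\<lambda>i. enc_nats (vs i))"
    and es: "ptime e D (\<lambda>i. enc_arcs (es i))"
  shows "ptime e D (\<lambda>i. enc_nats (reach_list (u i) (v i) (x i) (vs i) (es i)))"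
proof -
  obtain q where q: "\<And>i. i \<in> D \<Longrightarrow> size (enc_nats (vs i)) \<le> poly q (size (e i))"
    using ptime_size_bound[OF vs] by blast
  show ?thesis
    unfolding reach_list_def
  proof (rule ptime_fold_invariant[where g = enc_nat and xs = vs and h = enc_nats and q = q
        and init = "\<lambda>i. filter (\<lambda>w. w \<noteq> x i \<and> (w = u i \<or> w = v i)) (vs i)"
        and step = "\<lambda>i _. reach_step (x i) (vs i) (es i)" and Inv = "\<lambda>i R. \<exists>P. R = filter P (vs i)"])
    show "ptime e D (\<lambda>i. enc_nats (vs i))" by (rule vs)
    show "ptime e D (\<lambda>i. enc_nats (filter (\<lambda>w. w \<noteq> x i \<and> (w = u i \<or> w = v i)) (vs i)))"
      by (rule ptime_filter[OF vs])
        (rule ptime_logic ptime_args ptime_weaken[OF x] ptime_weaken[OF u] ptime_weaken[OF v] | simp)+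
    show "ptime (enc_pair enc_nat (enc_pair enc_nats e))
        {j. snd (snd j) \<in> D \<and> fst j \<in> set (vs (snd (snd j))) \<and>
          (\<exists>P. fst (snd j) = filter P (vs (snd (snd j))))}
        (\<lambda>j. enc_nats (reach_step (x (snd (snd j))) (vs (snd (snd j))) (es (snd (snd j))) (fst (snd j))))"
      by (rule ptime_reach_step)
        (rule ptime_weaken2[OF x] ptime_weaken2[OF vs] ptime_weaken2[OF es] ptime_args | simp)+
    show "size (enc_nats R) \<le> poly q (size (e i))" if i: "i \<in> D" and R: "\<exists>P. R = filter P (vs i)" for i R
    proof -
      obtain P where "R = filter P (vs i)" using R by blast
      then show ?thesis using q[OF i] size_enc_list_filter[of enc_nat P "vs i"] by simp
    qed
  qed (unfold reach_step_def, blast+)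
qed

lemma ptime_block_list:
  assumes u: "ptime e D (\<lambda>i. enc_nat (u i))" and v: "ptime e D (\<lambda>i. enc_nat (v i))"
    and vs: "ptime e D (\<lambda>i. enc_nats (vs i))" and es: "ptime e D (\<lambda>i. enc_arcs (es i))"
  shows "ptime e D (\<lambda>i. enc_nats (block_list (u i) (v i) (vs i) (es i)))"
  unfolding block_list_def
  by (rule ptime_filter[OF vs])
    (rule ptime_all[OF ptime_weaken[OF vs]] ptime_logic ptime_args ptime_reach_list
      ptime_weaken2[OF u] ptime_weaken2[OF v] ptime_weaken2[OF vs] ptime_weaken2[OF es] | simp)+

lemma ptime_singleton: "ptime e D (\<lambda>i. g (a i)) \<Longrightarrow> ptime e D (\<lambda>i. enc_list g [a i])"
  unfolding enc_list.simps by (rule ptime_Node[OF _ ptime_const])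

lemma ptime_block_inst:
  assumes p: "ptime e D (\<lambda>i. enc_pair enc_nat enc_nat (p i))" and k: "ptime e D (\<lambda>i. enc_nat (k i))"
    and vcs: "ptime e D (\<lambda>i. enc_lists (vcs i))" and es: "ptime e D (\<lambda>i. enc_arcs (es i))"
  shows "ptime e D (\<lambda>i. enc_inst (block_inst (p i) (k i) (vcs i, es i)))"
proof -
  note u = ptime_fst[OF p] and v = ptime_snd[OF p]
  have "ptime e D (\<lambda>i. enc_nats (map fst (vcs i)))"
    by (rule ptime_map[OF vcs]) (rule ptime_args)
  then have B: "ptime e D (\<lambda>i. enc_nats (block_list (fst (p i)) (snd (p i)) (map fst (vcs i)) (es i)))"
    by (rule ptime_block_list[OF u v _ es])
  have "ptime e D (\<lambda>i. enc_lists
     (map (\<lambda>q. (fst q, if fst q = fst (p i) then [k i] else snd q))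
       (filter (\<lambda>q. fst q \<in> set (block_list (fst (p i)) (snd (p i)) (map fst (vcs i)) (es i))) (vcs i))))"
    by (rule ptime_map_filter[OF vcs])
      (rule ptime_logic ptime_args ptime_weaken[OF B] ptime_enc_pair ptime_if_enc ptime_singleton
        ptime_weaken[OF u] ptime_weaken[OF k] | simp)+
  moreover have "ptime e D (\<lambda>i. enc_arcs (filter (\<lambda>a.
      fst a \<in> set (block_list (fst (p i)) (snd (p i)) (map fst (vcs i)) (es i)) \<and>
      snd a \<in> set (block_list (fst (p i)) (snd (p i)) (map fst (vcs i)) (es i))) (es i)))"
    by (rule ptime_filter[OF es]) (rule ptime_logic ptime_args ptime_weaken[OF B] | simp)+
  ultimately show ?thesis
    unfolding block_inst_def Let_def fst_conv snd_conv by (rule ptime_enc_pair)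
qed

text \<open>The only place where the solver for blocks is called. The last hypothesis is its
  promise, demanded just for the colours that are really tested.\<close>

lemma ptime_prune:
  assumes solver: "ptime enc_inst I (\<lambda>i. enc_bool (inst_yes i))"
    and p: "ptime e D (\<lambda>i. enc_pair enc_nat enc_nat (p i))"
    and vcs: "ptime e D (\<lambda>i. enc_lists (vcs i))" and es: "ptime e D (\<lambda>i. enc_arcs (es i))"
    and I: "\<And>i q k. i \<in> D \<Longrightarrow> q \<in> set (vcs i) \<Longrightarrow> fst q = fst (p i) \<Longrightarrow> k \<in> set (snd q)
      \<Longrightarrow> block_inst (p i) k (vcs i, es i) \<in> I"
  shows "ptime e D (\<lambda>i. enc_lists (prune (es i) (p i) (vcs i)))"
  unfolding prune_def
proof (rule ptime_map[OF vcs])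
  let ?e = "enc_pair (enc_pair enc_nat enc_nats) e"
  let ?D = "{j. snd j \<in> D \<and> fst j \<in> set (vcs (snd j))}"
  let ?D' = "{j \<in> ?D. fst (fst j) = fst (p (snd j))}"
  \<comment> \<open>The filter is analysed only for the entries of the vertex
    \<open>fst (p i)\<close>, since for other entries the queries need not lie in
    \<open>I\<close>.\<close>
  have "ptime ?e ?D' (\<lambda>j. enc_nats (filter
      (\<lambda>k. inst_yes (block_inst (p (snd j)) k (vcs (snd j), es (snd j)))) (snd (fst j))))"
  proof (rule ptime_filter)
    show "ptime ?e ?D' (\<lambda>j. enc_nats (snd (fst j)))" by (rule ptime_args)
    let ?D2 = "{j. snd j \<in> ?D' \<and> fst j \<in> set (snd (fst (snd j)))}"
    have "ptime (enc_pair enc_nat ?e) ?D2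
        (\<lambda>j. enc_inst (block_inst (p (snd (snd j))) (fst j) (vcs (snd (snd j)), es (snd (snd j)))))"
      by (rule ptime_block_inst)
        (rule ptime_weaken2[OF p] ptime_weaken2[OF vcs] ptime_weaken2[OF es] ptime_args | simp)+
    then show "ptime (enc_pair enc_nat ?e) ?D2 (\<lambda>j. enc_bool
        (inst_yes (block_inst (p (snd (snd j))) (fst j) (vcs (snd (snd j)), es (snd (snd j))))))"
      by (rule ptime_comp[OF _ solver]) (use I in blast)
  qed
  then show "ptime ?e ?D (\<lambda>j. enc_pair enc_nat enc_nats (fst (fst j),
      if fst (fst j) = fst (p (snd j))
      then filter (\<lambda>k. inst_yes (block_inst (p (snd j)) k (vcs (snd j), es (snd j)))) (snd (fst j))
      else snd (fst j)))"
    by - (rule ptime_enc_pair ptime_if_enc ptime_nat_eq ptime_args ptime_weaken[OF ptime_fst[OF p]]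
       | assumption | simp)+
qed

lemma shrinks_size: "shrinks a b \<Longrightarrow> size (enc_lists a) \<le> size (enc_lists b)"
  unfolding shrinks_def
proof (induction rule: list_all2_induct)
  case (Cons q a q' b)
  then show ?case using size_enc_list_filter[of enc_nat _ "snd q'"]
    by (auto simp: enc_pair_def intro: add_mono)
qed simp

lemma instances_shrinks:
  "(b, es) \<in> instances \<G> \<Longrightarrow> shrinks a b \<Longrightarrow> (a, es) \<in> instances \<G>"
  unfolding instances_def using shrinks_valid_inst shrinks_inst_graph by simp

text \<open>Discharges the promise of the solver. Membership of \<open>k\<close> in a list is used
  to exclude the colour 0.\<close>

lemma block_inst_in_instances:
  assumes "i \<in> instances \<G>" "\<forall>G\<in>\<G>. pair_graph G" "p \<in> set (snd i)" "k \<in> inst_lists (fst i) (fst p)"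
  shows "block_inst p k i \<in> instances (block_class \<G>)"
proof -
  have i: "valid_inst i" "inst_graph i \<in> \<G>" "pair_graph (inst_graph i)"
    using assms unfolding instances_def by auto
  have "is_block (inst_graph (block_inst p k i)) (inst_graph i)"
    by (rule block_inst_is_block[OF i(1,3) assms(3)])
  moreover have "valid_inst (block_inst p k i)"
    by (rule valid_block_inst[OF i(1,3) inst_lists_nonzero[OF i(1) assms(4)]])
  ultimately show ?thesis using i(2) unfolding instances_def block_class_def by blast
qed

lemma shrinks_prune_rounds: "shrinks a b \<Longrightarrow> shrinks (fold (\<lambda>_. prune_round es) ks a) b"
proof (induction ks arbitrary: a)
  case (Cons k ks)
  then have "shrinks (prune_round es a) b"
    using prune_round_properties[of es a] shrinks_trans by blast
  then show ?case using Cons.IH by simp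
qed simp

context
  fixes \<G> :: "nat pair_pre_digraph set"
  assumes graphs: "\<forall>G\<in>\<G>. pair_graph G"
    and solver: "ptime enc_inst (instances (block_class \<G>)) (\<lambda>i. enc_bool (inst_yes i))"
begin

text \<open>The instance \<open>\<iota> i\<close> stays in the context as a fixed reference: its
  lists bound the size of the current ones throughout, and its graph is the one whose blocks are
  queried.\<close>

lemma ptime_prune_round:
  assumes a: "ptime e D (\<lambda>i. enc_lists (a i))" and inst: "ptime e D (\<lambda>i. enc_inst (\<iota> i))"
    and D: "\<And>i. i \<in> D \<Longrightarrow> \<iota> i \<in> instances \<G> \<and> shrinks (a i) (fst (\<iota> i))"
  shows "ptime e D (\<lambda>i. enc_lists (prune_round (snd (\<iota> i)) (a i)))"
proof -
  note es = ptime_snd[OF inst]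
  obtain q where q: "\<And>i. i \<in> D \<Longrightarrow> size (enc_lists (fst (\<iota> i))) \<le> poly q (size (e i))"
    using ptime_size_bound[OF ptime_fst[OF inst]] by blast
  let ?D = "{j. snd (snd j) \<in> D \<and> fst j \<in> set (snd (\<iota> (snd (snd j)))) \<and>
    shrinks (fst (snd j)) (fst (\<iota> (snd (snd j))))}"
  show ?thesis
    unfolding prune_round_def
  proof (rule ptime_fold_invariant[where g = "enc_pair enc_nat enc_nat" and h = enc_lists and q = q
        and xs = "\<lambda>i. snd (\<iota> i)" and step = "\<lambda>i. prune (snd (\<iota> i))"
        and Inv = "\<lambda>i b. shrinks b (fst (\<iota> i))", OF es a])
    show "ptime (enc_pair (enc_pair enc_nat enc_nat) (enc_pair enc_lists e)) ?D
        (\<lambda>j. enc_lists (prune (snd (\<iota> (snd (snd j)))) (fst j) (fst (snd j))))"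
    proof (rule ptime_prune[OF solver])
      fix j q k
      assume j: "j \<in> ?D" "q \<in> set (fst (snd j))" "fst q = fst (fst j)" "k \<in> set (snd q)"
      let ?i = "\<iota> (snd (snd j))"
      have "snd (snd j) \<in> D" and shr: "shrinks (fst (snd j)) (fst ?i)" and arc: "fst j \<in> set (snd ?i)"
        using j(1) by simp_all
      then have "?i \<in> instances \<G>" using D by blast
      then have "(fst (snd j), snd ?i) \<in> instances \<G>"
        by (intro instances_shrinks[OF _ shr]) simp
      moreover have "k \<in> inst_lists (fst (snd j)) (fst (fst j))"
        using j(2-4) unfolding inst_lists_def by blast
      ultimately show "block_inst (fst j) k (fst (snd j), snd ?i) \<in> instances (block_class \<G>)"
        by (intro block_inst_in_instances[OF _ graphs]) (simp_all add: arc)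
    qed (rule ptime_args ptime_weaken2[OF es] | simp)+
    show "size (enc_lists b) \<le> poly q (size (e i))" if "i \<in> D" "shrinks b (fst (\<iota> i))" for i b
      using shrinks_size[OF that(2)] q[OF that(1)] by simp
  qed (use D shrinks_trans[OF shrinks_prune] in auto)
qed

lemma ptime_prune_rounds:
  assumes ks: "ptime e D (\<lambda>i. enc_nats (ks i))" and a: "ptime e D (\<lambda>i. enc_lists (a i))"
    and inst: "ptime e D (\<lambda>i. enc_inst (\<iota> i))"
    and D: "\<And>i. i \<in> D \<Longrightarrow> \<iota> i \<in> instances \<G> \<and> shrinks (a i) (fst (\<iota> i))"
  shows "ptime e D (\<lambda>i. enc_lists (fold (\<lambda>_. prune_round (snd (\<iota> i))) (ks i) (a i)))"
proof -
  obtain q where q: "\<And>i. i \<in> D \<Longrightarrow> size (enc_lists (fst (\<iota> i))) \<le> poly q (size (e i))"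
    using ptime_size_bound[OF ptime_fst[OF inst]] by blast
  show ?thesis
  proof (rule ptime_fold_invariant[where g = enc_nat and h = enc_lists and q = q
        and xs = ks and step = "\<lambda>i _. prune_round (snd (\<iota> i))"
        and Inv = "\<lambda>i b. shrinks b (fst (\<iota> i))", OF ks a])
    show "ptime (enc_pair enc_nat (enc_pair enc_lists e))
        {j. snd (snd j) \<in> D \<and> fst j \<in> set (ks (snd (snd j))) \<and>
          shrinks (fst (snd j)) (fst (\<iota> (snd (snd j))))}
        (\<lambda>j. enc_lists (prune_round (snd (\<iota> (snd (snd j)))) (fst (snd j))))"
      by (rule ptime_prune_round) (rule ptime_args ptime_weaken2[OF inst] | simp add: D)+
    show "size (enc_lists b) \<le> poly q (size (e i))" if "i \<in> D" "shrinks b (fst (\<iota> i))" for i b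
      using shrinks_size[OF that(2)] q[OF that(1)] by simp
    show "shrinks (prune_round (snd (\<iota> i)) b) (fst (\<iota> i))" if "shrinks b (fst (\<iota> i))" for i b
      using prune_round_properties[of "snd (\<iota> i)" b] that shrinks_trans by blast
  qed (use D in auto)
qed

lemma ptime_prune_all: "ptime enc_inst (instances \<G>) (\<lambda>i. enc_lists (prune_all i))"
  unfolding prune_all_def
proof (rule ptime_fold_invariant[where g = "enc_pair enc_nat enc_nats" and h = enc_lists
      and q = "[:0, 1:]" and xs = fst and init = fst
      and step = "\<lambda>i q. fold (\<lambda>_. prune_round (snd i)) (snd q)" and Inv = "\<lambda>i b. shrinks b (fst i)"])
  show "ptime enc_inst (instances \<G>) (\<lambda>i. enc_lists (fst i))" by (rule ptime_arg1)
  then show "ptime enc_inst (instances \<G>) (\<lambda>i. enc_lists (fst i))" .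
  show "ptime (enc_pair (enc_pair enc_nat enc_nats) (enc_pair enc_lists enc_inst))
      {j. snd (snd j) \<in> instances \<G> \<and> fst j \<in> set (fst (snd (snd j))) \<and>
        shrinks (fst (snd j)) (fst (snd (snd j)))}
      (\<lambda>j. enc_lists (fold (\<lambda>_. prune_round (snd (snd (snd j)))) (snd (fst j)) (fst (snd j))))"
    by (rule ptime_prune_rounds) (rule ptime_args | simp)+
  show "size (enc_lists b) \<le> poly [:0, 1:] (size (enc_inst i))" if "shrinks b (fst i)" for i b
    using shrinks_size[OF that] by (simp add: enc_pair_def)
qed (auto intro: shrinks_refl shrinks_prune_rounds)

lemma ptime_inst_yes: "ptime enc_inst (instances \<G>) (\<lambda>i. enc_bool (inst_yes i))"
proof -
  have "ptime enc_inst (instances \<G>)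
      (\<lambda>i. enc_bool (\<forall>q\<in>set (prune_all i). enc_nats (snd q) \<noteq> Leaf))"
    by (rule ptime_all[OF ptime_prune_all]) (rule ptime_not_Leaf ptime_args)+
  then show ?thesis
  proof (rule ptime_cong)
    fix i assume "i \<in> instances \<G>"
    then have "inst_yes i \<longleftrightarrow> (\<forall>q\<in>set (prune_all i). snd q \<noteq> [])"
      using graphs unfolding instances_def by (intro prune_all_correct) auto
    moreover have "enc_nats ks \<noteq> Leaf \<longleftrightarrow> ks \<noteq> []" for ks by (cases ks) auto
    ultimately show "enc_bool (\<forall>q\<in>set (prune_all i). enc_nats (snd q) \<noteq> Leaf) = enc_bool (inst_yes i)"
      by simp
  qed
qed

end

section \<open>Translation between list instances and codes\<close>

lemma enc_list_map: "enc_list f (map g xs) = enc_list (\<lambda>x. f (g x)) xs"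
  by (induction xs) auto

lemma enc_list_cong: "(\<And>x. x \<in> set xs \<Longrightarrow> f x = g x) \<Longrightarrow> enc_list f xs = enc_list g xs"
  by (induction xs) auto

lemma enc_arcs_eq: "enc_list (\<lambda>(u, v). Node (enc_nat u) (enc_nat v)) es = enc_arcs es"
  by (rule enc_list_cong) (auto simp: enc_pair_def)

lemma encodes_instance_enc_inst:
  assumes "valid_inst i"
  shows "encodes_instance (inst_graph i, inst_lists (fst i)) (enc_inst i)"
proof -
  let ?cols = "\<lambda>v. the (map_of (fst i) v)"
  have dist: "distinct (map fst (fst i))" using assms unfolding valid_inst_def by blast
  have cols: "?cols (fst q) = snd q" if "q \<in> set (fst i)" for q
  proof -
    have "(fst q, snd q) \<in> set (fst i)" using that by simp
    from map_of_is_SomeI[OF dist this] show ?thesis by simp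
  qed
  note lists = inst_lists_fst[OF dist]
  have "enc_list (\<lambda>v. Node (enc_nat v) (enc_nats (?cols v))) (map fst (fst i)) = enc_lists (fst i)"
    unfolding enc_list_map by (rule enc_list_cong) (simp add: cols enc_pair_def)
  then show ?thesis
    unfolding encodes_instance_def split_conv
    using assms cols lists unfolding valid_inst_def
    by (intro exI[of _ "map fst (fst i)"] exI[of _ "snd i"] exI[of _ ?cols])
      (simp add: inst_graph_def enc_arcs_eq, simp add: enc_pair_def)
qed

text \<open>The values of \<open>L\<close> outside the graph leave no trace in a code, so the lists
  agree on the vertices only. Validity includes that 0 is no colour, which comes from
  \<open>list_assignment\<close>.\<close>

lemma encodes_instanceE:
  assumes "encodes_instance (G, L) d" "list_assignment G L"
  obtains i where "d = enc_inst i" "valid_inst i" "inst_graph i = G"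
    "\<And>v. v \<in> pverts G \<Longrightarrow> inst_lists (fst i) v = L v"
proof -
  obtain vs es cols where d: "distinct vs" "set vs = pverts G" "distinct es" "set es = parcs G"
      "\<forall>v\<in>set vs. distinct (cols v) \<and> set (cols v) = L v"
      "d = Node (enc_list (\<lambda>v. Node (enc_nat v) (enc_list enc_nat (cols v))) vs)
              (enc_list (\<lambda>(u, v). Node (enc_nat u) (enc_nat v)) es)"
    using assms(1) unfolding encodes_instance_def by auto
  let ?i = "(map (\<lambda>v. (v, cols v)) vs, es)"
  show ?thesis
  proof (rule that[of ?i])
    show "d = enc_inst ?i"
      unfolding d(6) enc_arcs_eq by (simp add: enc_pair_def enc_list_map)
    have "0 \<notin> L v" if "v \<in> pverts G" for v
      using that assms(2) unfolding list_assignment_def by force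
    then show "valid_inst ?i"
      unfolding valid_inst_def using d(1-3,5) by (simp add: comp_def)
    show "inst_graph ?i = G"
      unfolding inst_graph_def using d(2,4) by (simp add: image_image)
    show "inst_lists (fst ?i) v = L v" if "v \<in> pverts G" for v
      unfolding inst_lists_def using d(2,5) that by auto
  qed
qed

text \<open>The codes of admissible instances are exactly the trees \<open>enc_inst i\<close> for
  valid \<open>i\<close>, so quantifying over \<open>i\<close> covers every ordering of vertices,
  arcs and colours. From left to right the program must also be made to clean up after itself; the
  size condition is trivial for a truth value.\<close>

lemma list_colouring_poly_time_on_iff_ptime:
  "list_colouring_poly_time_on \<G> \<longleftrightarrow> ptime enc_inst (instances \<G>) (\<lambda>i. enc_bool (inst_yes i))"
proof
  assume "list_colouring_poly_time_on \<G>"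
  then obtain c and p :: "nat poly" where run: "\<And>G L d. G \<in> \<G> \<Longrightarrow> list_assignment G L
      \<Longrightarrow> encodes_instance (G, L) d \<Longrightarrow> runs_within c d (poly p (size d))
            (enc_bool (\<exists>c. colouring G c \<and> respects_lists G L c))"
    unfolding list_colouring_poly_time_on_def poly_time_solvable_def by fastforce
  show "ptime enc_inst (instances \<G>) (\<lambda>i. enc_bool (inst_yes i))"
  proof (rule ptimeI)
    fix i assume i: "i \<in> instances \<G>"
    let ?n = "assigned_bound c"
    have "list_assignment (inst_graph i) (inst_lists (fst i))"
      using inst_lists_nonzero[of i] i
      unfolding list_assignment_def instances_def by (force simp: inst_lists_def)
    then have "runs_within c (enc_inst i) (poly p (size (enc_inst i))) (enc_bool (inst_yes i))"
      using run encodes_instance_enc_inst i unfolding instances_def inst_yes_def by blast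
    from runs_within_imp_computes[OF this]
    show "computes (Seq c (clear_below ?n)) (enc_inst i)
        (poly (p + [:2 * ?n + 1:]) (size (enc_inst i))) (enc_bool (inst_yes i))" by simp
    show "size (enc_bool (inst_yes i)) \<le> poly [:1:] (size (enc_inst i))"
      by (cases "inst_yes i") auto
  qed
next
  assume "ptime enc_inst (instances \<G>) (\<lambda>i. enc_bool (inst_yes i))"
  then obtain c and p :: "nat poly" where run: "\<And>i. i \<in> instances \<G> \<Longrightarrow>
      computes c (enc_inst i) (poly p (size (enc_inst i))) (enc_bool (inst_yes i))"
    unfolding ptime_def by blast
  show "list_colouring_poly_time_on \<G>"
    unfolding list_colouring_poly_time_on_def poly_time_solvable_def
  proof (intro exI[of _ c] exI[of _ p] ballI allI impI, clarify)
    fix G L d assume G: "G \<in> \<G>" "list_assignment G L" and d: "encodes_instance (G, L) d"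
    obtain i where i: "d = enc_inst i" "valid_inst i" "inst_graph i = G"
        "\<And>v. v \<in> pverts G \<Longrightarrow> inst_lists (fst i) v = L v"
      using encodes_instanceE[OF d G(2)] by metis
    have "inst_yes i \<longleftrightarrow> (\<exists>c. colouring G c \<and> respects_lists G L c)"
      unfolding inst_yes_def i(3) respects_lists_def using i(4) by auto
    then show "runs_within c d (poly p (size d)) (enc_bool (\<exists>c. colouring G c \<and> respects_lists G L c))"
      using computes_imp_runs_within[OF run[of i]] i(1-3) G(1) by (simp add: instances_def)
  qed
qed

theorem theorem15:
  fixes \<G> :: "nat pair_pre_digraph set"
  assumes "\<forall>G\<in>\<G>. pair_graph G"
    and "list_colouring_poly_time_on (block_class \<G>)"
  shows "list_colouring_poly_time_on \<G>"
  using assms ptime_inst_yes unfolding list_colouring_poly_time_on_iff_ptime by blast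

end
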